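(* The emptiness problem is undecidable for repetitive deterministic finite automata with translucent words (RDFAwtws); that is, there is no algorithm that, given an RDFAwtw $A$ (over an arbitrary finite input alphabet), decides whether $L(A)=\emptyset$.
   Context: **Automata.** A repetitive finite automaton with translucent words (RNFAwtw) is a tuple $A=(Q,\Sigma,\lhd,\tau,I,\delta)$, where $Q$ is a finite set of states, $\Sigma$ is a finite input alphabet, $\lhd\notin\Sigma$ is an end-of-tape marker, $I\subseteq Q$ is the set of initial states, $\tau$ maps each state to a finite subset of $\Sigma^*$ (its translucent words), and $\delta$ is a transition function with $\delta(q,a)\subseteq Q$ for $q\in Q$, $a\in\Sigma$, and with $\delta(q,\lhd)$ either a subset of $Q$ or an element of $\{\mathsf{Accept},\mathsf{Reject}\}$ for $q\in Q$. Put $\Sigma_q=\{a\in\Sigma\mid\delta(q,a)\neq\emptyset\}$. It is required for each $q$ that, if $\tau(q)\ne\emptyset$, then $\tau(q)$ is a finite prefix code (a set of non-empty words none of which is a proper prefix of another one), and that no word of $\tau(q)$ begins with a letter of $\Sigma_q$. Such an automaton is a finite object and is given to an algorithm by listing its components. **Computations.** Configurations are words $qw\cdot\lhd$ ($q\in Q$, $w\in\Sigma^*$), together with $\mathsf{Accept}$ and $\mathsf{Reject}$. The single-step relation $\vdash_A$ on $qw\cdot\lhd$ is: - if $w=uav$ with $u\in(\tau(q))^*$, $a\in\Sigma_q$, $v\in\Sigma^*$, then $qw\cdot\lhd\vdash_A q'uv\cdot\lhd$ for each $q'\in\delta(q,a)$; - if $w=uav$ with $u\in(\tau(q))^*$,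 $a\in\Sigma\setminus\Sigma_q$, $v\in\Sigma^*$ and $av\notin\tau(q)\cdot\Sigma^*$, then $qw\cdot\lhd\vdash_A\mathsf{Reject}$; - if $w\in(\tau(q))^*$, then $qw\cdot\lhd\vdash_A\mathsf{Accept}$ if $\delta(q,\lhd)=\mathsf{Accept}$; $qw\cdot\lhd\vdash_A\mathsf{Reject}$ if $\delta(q,\lhd)=\mathsf{Reject}$ or $\delta(q,\lhd)=\emptyset$; and $qw\cdot\lhd\vdash_A q'w\cdot\lhd$ for each $q'\in\delta(q,\lhd)$ if $\delta(q,\lhd)\subseteq Q$. $L(A)$ is the set of all $w\in\Sigma^*$ such that $q_0w\cdot\lhd\vdash_A^*\mathsf{Accept}$ for some $q_0\in I$, where $\vdash_A^*$ is the reflexive transitive closure of $\vdash_A$. An RNFAwtw is deterministic (an RDFAwtw) if $|I|=1$, $|\delta(q,a)|\le 1$ for all $q\in Q$, $a\in\Sigma$, and $|\delta(q,\lhd)|\le1$ whenever $\delta(q,\lhd)\subseteq Q$. *)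

theory Defs
  imports Main "HOL-Library.Sublist" "HOL-Library.Nat_Bijection"
begin

section \<open>Repetitive finite automata with translucent words\<close>

datatype 'q action = Goto "'q set" | Acc | Rej

text \<open>
  The end-of-tape marker has the same type as the letters, so that a single transition
  function covers letters and marker.
\<close>

record ('q, 'a) automaton =
  states :: "'q set"
  alphabet :: "'a set"
  marker :: 'a
  transl :: "'q \<Rightarrow> 'a list set"
  initials :: "'q set"
  delta :: "'q \<Rightarrow> 'a \<Rightarrow> 'q action"

definition readable :: "('q, 'a) automaton \<Rightarrow> 'q \<Rightarrow> 'a set" where
  "readable A q = {a \<in> alphabet A. delta A q a \<noteq> Goto {}}"

definition prefix_code :: "'a list set \<Rightarrow> bool" where
  "prefix_code X \<longleftrightarrow> [] \<notin> X \<and> (\<forall>x\<in>X. \<forall>y\<in>X. \<not> strict_prefix x y)"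

definition rnfawtw :: "('q, 'a) automaton \<Rightarrow> bool" where
  "rnfawtw A \<longleftrightarrow>
     finite (states A) \<and> finite (alphabet A) \<and> marker A \<notin> alphabet A \<and>
     initials A \<subseteq> states A \<and>
     (\<forall>q\<in>states A. \<forall>a\<in>alphabet A. \<exists>S. S \<subseteq> states A \<and> delta A q a = Goto S) \<and>
     (\<forall>q\<in>states A. \<forall>S. delta A q (marker A) = Goto S \<longrightarrow> S \<subseteq> states A) \<and>
     (\<forall>q\<in>states A. finite (transl A q) \<and> transl A q \<subseteq> lists (alphabet A)) \<and>
     (\<forall>q\<in>states A. transl A q \<noteq> {} \<longrightarrow>
        prefix_code (transl A q) \<and> (\<forall>x\<in>transl A q. hd x \<notin> readable A q))"

definition rdfawtw :: "('q, 'a) automaton \<Rightarrow> bool" where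
  "rdfawtw A \<longleftrightarrow> rnfawtw A \<and> card (initials A) = 1 \<and>
     (\<forall>q\<in>states A. \<forall>a\<in>insert (marker A) (alphabet A). \<forall>S.
        delta A q a = Goto S \<longrightarrow> card S \<le> 1)"


section \<open>Computations\<close>

text \<open>\<open>Config q w\<close> stands for the configuration consisting of \<open>q\<close>, \<open>w\<close> and the end marker.\<close>

datatype ('q, 'a) config = Config 'q "'a list" | Accept | Reject

definition kstar :: "'a list set \<Rightarrow> 'a list set" where
  "kstar X = concat ` lists X"

inductive step :: "('q, 'a) automaton \<Rightarrow> ('q, 'a) config \<Rightarrow> ('q, 'a) config \<Rightarrow> bool"
  for A where
  read: "step A (Config q (u @ a # v)) (Config q' (u @ v))"
    if "q \<in> states A" "u \<in> kstar (transl A q)" "a \<in> readable A q" "v \<in> lists (alphabet A)"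
      "delta A q a = Goto S" "q' \<in> S"
| stuck: "step A (Config q (u @ a # v)) Reject"
    if "q \<in> states A" "u \<in> kstar (transl A q)" "a \<in> alphabet A - readable A q"
      "v \<in> lists (alphabet A)"
      "\<not> (\<exists>x\<in>transl A q. \<exists>y\<in>lists (alphabet A). a # v = x @ y)"
| end_accept: "step A (Config q w) Accept"
    if "q \<in> states A" "w \<in> kstar (transl A q)" "delta A q (marker A) = Acc"
| end_reject: "step A (Config q w) Reject"
    if "q \<in> states A" "w \<in> kstar (transl A q)"
      "delta A q (marker A) = Rej \<or> delta A q (marker A) = Goto {}"
| end_goto: "step A (Config q w) (Config q' w)"
    if "q \<in> states A" "w \<in> kstar (transl A q)" "delta A q (marker A) = Goto S" "q' \<in> S"

definition language :: "('q, 'a) automaton \<Rightarrow> 'a list set" where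
  "language A =
     {w \<in> lists (alphabet A). \<exists>q\<in>initials A. (step A)\<^sup>*\<^sup>* (Config q w) Accept}"


section \<open>Algorithms\<close>

text \<open>
  Algorithms are partial recursive (mu-recursive) functions. \<open>computes f xs y\<close> says that \<open>f\<close>
  halts on the arguments \<open>xs\<close> with result \<open>y\<close>. Terms carry no arity: a term of the textbook
  definition is recovered by fixing the length of \<open>xs\<close>, and where a subterm does not fit the
  length of its argument list there is no result.
\<close>

datatype recfun =
  Zero | Succ | Proj nat | Comp recfun "recfun list" | PrimRec recfun recfun | Mu recfun

inductive computes :: "recfun \<Rightarrow> nat list \<Rightarrow> nat \<Rightarrow> bool" where
  zero: "computes Zero xs 0"
| succ: "computes Succ [x] (Suc x)"
| proj: "i < length xs \<Longrightarrow> computes (Proj i) xs (xs ! i)"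
| comp: "list_all2 (\<lambda>g y. computes g xs y) gs ys \<Longrightarrow> computes f ys z \<Longrightarrow>
    computes (Comp f gs) xs z"
| prim_0: "computes f xs y \<Longrightarrow> computes (PrimRec f g) (0 # xs) y"
| prim_Suc: "computes (PrimRec f g) (n # xs) y \<Longrightarrow> computes g (n # y # xs) z \<Longrightarrow>
    computes (PrimRec f g) (Suc n # xs) z"
| mu: "computes f (n # xs) 0 \<Longrightarrow> (\<forall>m<n. \<exists>y. computes f (m # xs) (Suc y)) \<Longrightarrow>
    computes (Mu f) xs n"

lemma computes_deterministic: "computes f xs y \<Longrightarrow> computes f xs z \<Longrightarrow> y = z"
proof (induction arbitrary: z rule: computes.induct)
  case (zero xs)
  then show ?case by cases simp
next
  case (succ x)
  then show ?case by cases simp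
next
  case (proj i xs)
  from proj(2) show ?case by cases simp
next
  case (comp xs gs ys f y)
  from comp.prems obtain zs where zs: "list_all2 (\<lambda>g y. computes g xs y) gs zs" "computes f zs z"
    by cases simp
  have "ys = zs"
    using comp.IH(1) zs(1) by (auto simp: list_all2_conv_all_nth intro: nth_equalityI)
  then show ?case using comp.IH(2) zs(2) by blast
next
  case (prim_0 f xs y g)
  from prim_0.prems show ?case by cases (simp add: prim_0.IH)
next
  case (prim_Suc f g n xs y w)
  from prim_Suc.prems obtain y' where "computes (PrimRec f g) (n # xs) y'"
    "computes g (n # y' # xs) z"
    by cases simp
  then show ?case using prim_Suc.IH by blast
next
  case (mu f n xs)
  from mu.prems have z: "computes f (z # xs) 0" "\<forall>m<z. \<exists>y. computes f (m # xs) (Suc y)"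
    by (cases, simp)+
  show ?case
  proof (rule linorder_cases)
    assume "n < z"
    then show ?thesis using mu.IH(1) z(2) by blast
  next
    assume "z < n"
    then show ?thesis using mu.IH(2) z(1) by blast
  qed
qed


section \<open>Automata as input\<close>

text \<open>
  An automaton whose states and letters are natural numbers is listed as: its states, its
  alphabet, its marker, the pairs \<open>(q, x)\<close> with \<open>x\<close> a translucent word of \<open>q\<close>, its initial
  states, and the entries of its transition table. A table entry \<open>(q, a, c)\<close> with \<open>c = 0\<close>
  or \<open>c = 1\<close> is acceptance or rejection, and with \<open>c = q' + 2\<close> it is a move to \<open>q'\<close>; the
  value \<open>Goto {}\<close> has no entry. Order and repetitions in the lists are irrelevant.
\<close>

type_synonym listing =
  "nat list \<times> nat list \<times> nat \<times> (nat \<times> nat list) list \<times> nat list \<times> (nat \<times> nat \<times> nat) list"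

fun entries :: "nat action \<Rightarrow> nat set" where
  "entries Acc = {0}"
| "entries Rej = {1}"
| "entries (Goto S) = (\<lambda>q. q + 2) ` S"

fun is_listing :: "listing \<Rightarrow> (nat, nat) automaton \<Rightarrow> bool" where
  "is_listing (qs, as, e, ts, is, ds) A \<longleftrightarrow>
     set qs = states A \<and> set as = alphabet A \<and> e = marker A \<and>
     set ts = {(q, x). q \<in> states A \<and> x \<in> transl A q} \<and>
     set is = initials A \<and>
     set ds = {(q, a, c). q \<in> states A \<and> a \<in> insert (marker A) (alphabet A) \<and>
       c \<in> entries (delta A q a)}"

fun code :: "listing \<Rightarrow> nat" where
  "code (qs, as, e, ts, is, ds) =
     list_encode
       [list_encode qs, list_encode as, e,
        list_encode (map (\<lambda>(q, x). prod_encode (q, list_encode x)) ts),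
        list_encode is,
        list_encode (map (\<lambda>(q, a, c). prod_encode (q, prod_encode (a, c))) ds)]"

lemma listing_exists:
  assumes "rnfawtw A"
  shows "\<exists>l. is_listing l A"
proof -
  have fin: "finite (states A)" "finite (alphabet A)" "finite (initials A)"
    "\<And>q. q \<in> states A \<Longrightarrow> finite (transl A q)"
    using assms by (auto simp: rnfawtw_def intro: finite_subset)
  have goto: "S \<subseteq> states A"
    if "q \<in> states A" "a \<in> insert (marker A) (alphabet A)" "delta A q a = Goto S" for q a S
    using assms that unfolding rnfawtw_def by (metis action.inject insert_iff)
  have ent: "finite (entries (delta A q a))"
    if "q \<in> states A" "a \<in> insert (marker A) (alphabet A)" for q a
  proof (cases "delta A q a")
    case (Goto S)
    then show ?thesis using goto[OF that Goto] fin(1) by (simp add: finite_subset)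
  qed auto
  have "{(q, x). q \<in> states A \<and> x \<in> transl A q} = Sigma (states A) (transl A)"
    by auto
  then have "finite {(q, x). q \<in> states A \<and> x \<in> transl A q}"
    using fin by auto
  then obtain ts where ts: "set ts = {(q, x). q \<in> states A \<and> x \<in> transl A q}"
    using finite_list by blast
  have "{(q, a, c). q \<in> states A \<and> a \<in> insert (marker A) (alphabet A) \<and>
      c \<in> entries (delta A q a)} =
    (SIGMA q:states A. SIGMA a:insert (marker A) (alphabet A). entries (delta A q a))"
    by auto
  then have "finite {(q, a, c). q \<in> states A \<and> a \<in> insert (marker A) (alphabet A) \<and>
      c \<in> entries (delta A q a)}"
    using fin ent by (simp only:) (intro finite_SigmaI finite.insertI; blast)
  then obtain ds where ds: "set ds = {(q, a, c). q \<in> states A \<and>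
      a \<in> insert (marker A) (alphabet A) \<and> c \<in> entries (delta A q a)}"
    using finite_list by blast
  obtain qs as "is" where "set qs = states A" "set as = alphabet A" "set is = initials A"
    using fin finite_list by metis
  with ts ds have "is_listing (qs, as, marker A, ts, is, ds) A" by simp
  then show ?thesis by blast
qed

end

theory Submission imports Defs begin

text \<open>
  An automaton can run a counter machine on a guessed tape. The input is a word over blocks
  consisting of a seal of colour \<open>j\<close> followed by a token of colour \<open>j\<close>; a first pass with the
  blocks as translucent words checks this without deleting anything. Afterwards the tape is
  always a string of free tokens followed by intact blocks, and the value of register \<open>j\<close> is
  the number of free tokens of colour \<open>j\<close>. To increment \<open>j\<close>, skip the free tokens and delete
  the next seal, which must have colour \<open>j\<close>. To decrement \<open>j\<close>, skip all blocks and all free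
  tokens of other colours and delete a token of colour \<open>j\<close>; reaching the end of the tape means
  that the register is zero. So the language is nonempty iff the counter machine halts
  properly, because the sequence of increments of a halting run can be guessed.

  The rest is diagonalisation. Register 0 is initialised with \<open>n\<close> by a chain of \<open>n\<close> states, so
  for a fixed machine the code of the automaton is a recursive function of \<open>n\<close> and of a few
  constants describing the machine. Given a decider, take the machine that rebuilds from \<open>n\<close>
  the code of an automaton, asks the decider about it, and is accepted iff the answer is
  ``empty''. With \<open>n\<close> the tuple of constants of that very machine, the automaton in question is
  its own.
\<close>

section \<open>Recursive functions\<close>

text \<open>Totality is built in. Terms carry no arity, so \<open>k\<close> fixes the length of the
  argument lists; values of \<open>f\<close> on other lengths are arbitrary, whence the side
  condition in \<open>recursive_cong\<close>.\<close>

definition recursive :: "nat \<Rightarrow> (nat list \<Rightarrow> nat) \<Rightarrow> bool" where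
  "recursive k f \<longleftrightarrow> (\<exists>r. \<forall>xs. length xs = k \<longrightarrow> computes r xs (f xs))"

lemma recursive_cong:
  assumes "recursive k f" "\<And>xs. length xs = k \<Longrightarrow> f xs = g xs"
  shows "recursive k g"
  using assms unfolding recursive_def by fastforce

lemma recursive_nth: "i < k \<Longrightarrow> recursive k (\<lambda>xs. xs ! i)"
  unfolding recursive_def by (blast intro: computes.proj)

lemma recursive_compose:
  assumes f: "recursive (length gs) f" and gs: "\<And>g. g \<in> set gs \<Longrightarrow> recursive k g"
  shows "recursive k (\<lambda>xs. f (map (\<lambda>g. g xs) gs))"
proof -
  obtain rf where rf: "\<And>ys. length ys = length gs \<Longrightarrow> computes rf ys (f ys)"
    using f unfolding recursive_def by blast
  obtain R where R: "\<And>g xs. g \<in> set gs \<Longrightarrow> length xs = k \<Longrightarrow> computes (R g) xs (g xs)"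
    using gs unfolding recursive_def by metis
  have "computes (Comp rf (map R gs)) xs (f (map (\<lambda>g. g xs) gs))" if "length xs = k" for xs
    by (rule computes.comp[where ys = "map (\<lambda>g. g xs) gs"])
      (use rf R that in \<open>auto simp: list_all2_conv_all_nth\<close>)
  then show ?thesis unfolding recursive_def by blast
qed

lemma recursive_compose1:
  assumes "recursive 1 (\<lambda>xs. f (xs ! 0))" "recursive k g"
  shows "recursive k (\<lambda>xs. f (g xs))"
  using recursive_compose[of "[g]" "\<lambda>xs. f (xs ! 0)" k] assms by simp

lemma recursive_Suc:
  assumes "recursive k f"
  shows "recursive k (\<lambda>xs. Suc (f xs))"
proof (rule recursive_compose1[OF _ assms])
  have "computes Succ xs (Suc (xs ! 0))" if "length xs = 1" for xs
    using that computes.succ[of "xs ! 0"] by (cases xs) auto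
  then show "recursive 1 (\<lambda>xs. Suc (xs ! 0))"
    unfolding recursive_def by blast
qed

lemma recursive_const: "recursive k (\<lambda>_. n)"
proof (induction n)
  case 0
  show ?case unfolding recursive_def by (blast intro: computes.zero)
qed (rule recursive_Suc)

text \<open>In a primitive recursion the step function sees the counter and the previous value in
  front of the parameters. This carries a function of the parameters over to that longer
  list.\<close>

lemma recursive_drop:
  assumes "recursive k f"
  shows "recursive (Suc (Suc k)) (\<lambda>ys. f (drop 2 ys))"
proof -
  have "recursive (Suc (Suc k)) (\<lambda>ys. f (map (\<lambda>g. g ys) (map (\<lambda>i ys. ys ! (i + 2)) [0..<k])))"
    by (rule recursive_compose) (use assms in \<open>auto intro: recursive_nth\<close>)
  then show ?thesis
    by (rule recursive_cong) (auto intro!: arg_cong[where f = f] nth_equalityI simp: add.commute)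
qed

lemma computes_PrimRec:
  assumes "computes f xs y0" "\<And>n y. computes g (n # y # xs) (h n y)"
  shows "computes (PrimRec f g) (m # xs) (rec_nat y0 h m)"
  using assms by (induction m) (auto intro: computes.prim_0 computes.prim_Suc)

lemma recursive_rec_nat:
  assumes m: "recursive k m" and a: "recursive k a"
    and h: "recursive (Suc (Suc k)) (\<lambda>ys. h (ys ! 0) (ys ! 1) (drop 2 ys))"
  shows "recursive k (\<lambda>xs. rec_nat (a xs) (\<lambda>n y. h n y xs) (m xs))"
proof -
  obtain ra rh where r: "\<And>xs. length xs = k \<Longrightarrow> computes ra xs (a xs)"
    "\<And>ys. length ys = Suc (Suc k) \<Longrightarrow> computes rh ys (h (ys ! 0) (ys ! 1) (drop 2 ys))"
    using a h unfolding recursive_def by blast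
  have step: "computes rh (n # y # xs) (h n y xs)" if "length xs = k" for n y xs
    using r(2)[of "n # y # xs"] that by simp
  have "computes (PrimRec ra rh) ys (rec_nat (a (tl ys)) (\<lambda>n y. h n y (tl ys)) (hd ys))"
    if "length ys = Suc k" for ys
    using that r(1) step by (cases ys) (auto intro!: computes_PrimRec)
  then have "recursive (Suc k) (\<lambda>ys. rec_nat (a (tl ys)) (\<lambda>n y. h n y (tl ys)) (hd ys))"
    unfolding recursive_def by blast
  \<comment> \<open>\<open>PrimRec\<close> recurses on its first argument, so composition with
    \<open>m\<close> and all projections puts the bound in front of the unchanged list.\<close>
  then have "recursive k (\<lambda>xs. (\<lambda>ys. rec_nat (a (tl ys)) (\<lambda>n y. h n y (tl ys)) (hd ys))
      (map (\<lambda>g. g xs) (m # map (\<lambda>i xs. xs ! i) [0..<k])))"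
    by (intro recursive_compose) (use m in \<open>auto intro: recursive_nth\<close>)
  moreover have "map (\<lambda>i. xs ! i) [0..<k] = xs" if "length xs = k" for xs :: "nat list"
    using that map_nth by blast
  ultimately show ?thesis
    by (elim recursive_cong) (simp add: comp_def)
qed

lemma recursive_Least:
  assumes g: "recursive (Suc k) g" and ex: "\<And>xs. length xs = k \<Longrightarrow> \<exists>n. g (n # xs) = 0"
  shows "recursive k (\<lambda>xs. LEAST n. g (n # xs) = 0)"
proof -
  obtain r where r: "\<And>ys. length ys = Suc k \<Longrightarrow> computes r ys (g ys)"
    using g unfolding recursive_def by blast
  have "computes (Mu r) xs (LEAST n. g (n # xs) = 0)" if len: "length xs = k" for xs
  proof (rule computes.mu)
    show "computes r ((LEAST n. g (n # xs) = 0) # xs) 0"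
      using r[of "(LEAST n. g (n # xs) = 0) # xs"] LeastI_ex[OF ex[OF len]] len by simp
    show "\<forall>m<LEAST n. g (n # xs) = 0. \<exists>y. computes r (m # xs) (Suc y)"
    proof (intro allI impI)
      fix m assume "m < (LEAST n. g (n # xs) = 0)"
      then have "g (m # xs) \<noteq> 0" by (rule not_less_Least)
      then show "\<exists>y. computes r (m # xs) (Suc y)"
        using r[of "m # xs"] len by (metis length_Cons not0_implies_Suc)
    qed
  qed
  then show ?thesis unfolding recursive_def by blast
qed

section \<open>Arithmetic and the pairing function\<close>

lemma recursive_add:
  assumes "recursive k f" "recursive k g"
  shows "recursive k (\<lambda>xs. f xs + g xs)"
proof -
  have "recursive k (\<lambda>xs. rec_nat (g xs) (\<lambda>n y. Suc y) (f xs))"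
    by (intro recursive_rec_nat assms recursive_Suc recursive_nth) simp
  moreover have "rec_nat b (\<lambda>n. Suc) a = a + b" for a b :: nat
    by (induction a) auto
  ultimately show ?thesis by simp
qed

lemma recursive_diff:
  assumes "recursive k f" "recursive k g"
  shows "recursive k (\<lambda>xs. f xs - g xs)"
proof -
  have pred: "recursive j (\<lambda>xs. h xs - 1)" if "recursive j h" for j h
  proof -
    have "recursive j (\<lambda>xs. rec_nat 0 (\<lambda>n y. n) (h xs))"
      by (intro recursive_rec_nat that recursive_const recursive_nth) simp
    moreover have "rec_nat 0 (\<lambda>n y. n) a = a - 1" for a :: nat
      by (cases a) auto
    ultimately show ?thesis by simp
  qed
  have "recursive k (\<lambda>xs. rec_nat (f xs) (\<lambda>n y. y - 1) (g xs))"
    by (intro recursive_rec_nat assms pred recursive_nth) simp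
  moreover have "rec_nat a (\<lambda>n y. y - 1) b = a - b" for a b :: nat
    by (induction b) auto
  ultimately show ?thesis by simp
qed

lemma recursive_triangle:
  assumes "recursive k f"
  shows "recursive k (\<lambda>xs. triangle (f xs))"
proof -
  have "recursive k (\<lambda>xs. rec_nat 0 (\<lambda>n y. y + Suc n) (f xs))"
    by (intro recursive_rec_nat assms recursive_add recursive_Suc recursive_const recursive_nth)
      simp_all
  moreover have "rec_nat 0 (\<lambda>n y. y + Suc n) a = triangle a" for a :: nat
    by (induction a) auto
  ultimately show ?thesis by simp
qed

lemma recursive_prod_encode:
  assumes "recursive k f" "recursive k g"
  shows "recursive k (\<lambda>xs. prod_encode (f xs, g xs))"
  unfolding prod_encode_def using assms
  by (simp add: recursive_add recursive_triangle)

lemma triangle_mono: "m \<le> n \<Longrightarrow> triangle m \<le> triangle n"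
  by (induction rule: dec_induct) auto

text \<open>\<open>prod_encode (a, b)\<close> is \<open>triangle (a + b) + a\<close>, so it suffices
  to find \<open>a + b\<close>, the diagonal on which the code lies; a minimum search does
  this.\<close>

lemma recursive_prod_decode:
  assumes "recursive k f"
  shows "recursive k (\<lambda>xs. fst (prod_decode (f xs)))"
    and "recursive k (\<lambda>xs. snd (prod_decode (f xs)))"
proof -
  \<comment> \<open>Truncated subtraction turns \<open>c < triangle (Suc s)\<close> into an equation
    with 0, the form that \<open>recursive_Least\<close> handles.\<close>
  define diag where "diag c = (LEAST s. Suc c - triangle (Suc s) = 0)" for c
  have diag: "diag (prod_encode (a, b)) = a + b" for a b
    unfolding diag_def
  proof (rule Least_equality)
    show "Suc (prod_encode (a, b)) - triangle (Suc (a + b)) = 0"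
      by (simp add: prod_encode_def)
    show "a + b \<le> s" if "Suc (prod_encode (a, b)) - triangle (Suc s) = 0" for s
    proof (rule ccontr)
      assume "\<not> a + b \<le> s"
      then have "triangle (Suc s) \<le> triangle (a + b)" by (intro triangle_mono) simp
      with that show False by (simp add: prod_encode_def del: triangle_Suc)
    qed
  qed
  have "recursive (Suc 1) (\<lambda>ys. Suc (ys ! 1) - triangle (Suc (ys ! 0)))"
    by (intro recursive_diff recursive_triangle recursive_Suc recursive_nth) simp_all
  then have "recursive 1 (\<lambda>xs. LEAST s. Suc ((s # xs) ! 1) - triangle (Suc ((s # xs) ! 0)) = 0)"
  proof (rule recursive_Least)
    fix xs :: "nat list"
    have "n \<le> triangle n" for n by (induction n) auto
    then show "\<exists>n. Suc ((n # xs) ! 1) - triangle (Suc ((n # xs) ! 0)) = 0"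
      by (intro exI[of _ "xs ! 0"]) (metis diff_is_0_eq nth_Cons_0 nth_Cons_Suc One_nat_def)
  qed
  then have "recursive 1 (\<lambda>xs. diag (xs ! 0))"
    by (simp add: diag_def)
  note rdiag = recursive_compose1[OF this assms]
  have fst: "fst (prod_decode c) = c - triangle (diag c)"
    and snd: "snd (prod_decode c) = diag c - (c - triangle (diag c))" for c
  proof -
    obtain a b where c: "c = prod_encode (a, b)"
      by (metis prod_decode_inverse surj_pair)
    have "c - triangle (diag c) = a"
      unfolding c diag by (simp add: prod_encode_def)
    then show "fst (prod_decode c) = c - triangle (diag c)"
      "snd (prod_decode c) = diag c - (c - triangle (diag c))"
      by (simp_all add: c diag)
  qed
  show "recursive k (\<lambda>xs. fst (prod_decode (f xs)))"
    unfolding fst by (intro recursive_diff recursive_triangle rdiag assms)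
  show "recursive k (\<lambda>xs. snd (prod_decode (f xs)))"
    unfolding snd by (intro recursive_diff recursive_triangle rdiag assms)
qed

section \<open>Compiling recursive functions to register programs\<close>

datatype com = SKIP | INC nat | SEQ com com (infixr ";;" 60) | LOOP nat com

text \<open>Despite its name, \<open>LOOP\<close> is a while loop: before every round
  \<open>r\<close> is tested and decremented, and the body may change \<open>r\<close>. This is what
  makes unbounded search expressible.\<close>

inductive exec :: "com \<Rightarrow> (nat \<Rightarrow> nat) \<Rightarrow> (nat \<Rightarrow> nat) \<Rightarrow> bool" where
  skip: "exec SKIP s s"
| inc: "exec (INC r) s (s(r := Suc (s r)))"
| seq: "exec c s t \<Longrightarrow> exec d t u \<Longrightarrow> exec (c ;; d) s u"
| loop_end: "s r = 0 \<Longrightarrow> exec (LOOP r c) s s"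
| loop_step: "s r = Suc n \<Longrightarrow> exec c (s(r := n)) t \<Longrightarrow> exec (LOOP r c) t u \<Longrightarrow>
    exec (LOOP r c) s u"

definition clear :: "nat \<Rightarrow> com" where
  "clear r = LOOP r SKIP"

text \<open>Reading a register destroys it, so \<open>x\<close> is emptied into \<open>y\<close> and
  the scratch register \<open>t\<close> together and then refilled from \<open>t\<close>.\<close>

definition copy :: "nat \<Rightarrow> nat \<Rightarrow> nat \<Rightarrow> com" where
  "copy x y t = clear y ;; clear t ;; LOOP x (INC y ;; INC t) ;; LOOP t (INC x)"

text \<open>The registers \<open>ins\<close> hold the arguments, \<open>out\<close> receives the
  result, and everything from \<open>k\<close> on is scratch; \<open>compile_list\<close> stores its
  results from \<open>k\<close> on and has its scratch from \<open>b\<close> on. In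
  \<open>PrimRec\<close>, \<open>k\<close> holds the remaining rounds, \<open>k + 1\<close> the
  counter, \<open>k + 2\<close> the current value and \<open>k + 3\<close> the next one. In
  \<open>Mu\<close>, \<open>k\<close> holds the candidate and \<open>k + 1\<close> the value of
  \<open>f\<close> there.\<close>

fun compile :: "recfun \<Rightarrow> nat list \<Rightarrow> nat \<Rightarrow> nat \<Rightarrow> com"
  and compile_list :: "recfun list \<Rightarrow> nat list \<Rightarrow> nat \<Rightarrow> nat \<Rightarrow> com" where
  "compile Zero ins out k = clear out"
| "compile Succ ins out k = copy (hd ins) out k ;; INC out"
| "compile (Proj i) ins out k = copy (ins ! i) out k"
| "compile (Comp f gs) ins out k = compile_list gs ins k (k + length gs) ;;
     compile f [k..<k + length gs] out (k + length gs)"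
| "compile (PrimRec f g) ins out k =
     compile f (tl ins) (k + 2) (k + 3) ;; copy (hd ins) k (k + 3) ;; clear (k + 1) ;;
     LOOP k (compile g ((k + 1) # (k + 2) # tl ins) (k + 3) (k + 4) ;;
       copy (k + 3) (k + 2) (k + 4) ;; INC (k + 1)) ;;
     copy (k + 2) out (k + 3)"
| "compile (Mu f) ins out k =
     clear k ;; compile f (k # ins) (k + 1) (k + 2) ;;
     LOOP (k + 1) (INC k ;; compile f (k # ins) (k + 1) (k + 2)) ;; copy k out (k + 2)"
| "compile_list [] ins k b = SKIP"
| "compile_list (g # gs) ins k b = compile g ins k b ;; compile_list gs ins (Suc k) b"

section \<open>Correctness of the compiler\<close>

lemma exec_clear: "exec (clear r) s (s(r := 0))"
proof -
  have "exec (LOOP r SKIP) s (s(r := 0))" if "s r = n" for n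
    using that
  proof (induction n arbitrary: s)
    case 0
    then show ?case using exec.loop_end[of s r] by (metis fun_upd_triv)
  next
    case (Suc n)
    have "exec (LOOP r SKIP) (s(r := n)) (s(r := 0))"
      using Suc.IH[of "s(r := n)"] by (metis fun_upd_same fun_upd_upd)
    then show ?case by (rule exec.loop_step[where s = s, OF Suc.prems exec.skip])
  qed
  then show ?thesis unfolding clear_def by blast
qed

lemma exec_copy:
  assumes "x \<noteq> y" "x \<noteq> t" "y \<noteq> t"
  shows "exec (copy x y t) s (s(y := s x, t := 0))"
proof -
  have spread: "exec (LOOP x (INC y ;; INC t)) s (s(x := 0, y := s y + n, t := s t + n))"
    if "s x = n" for n s
    using that
  proof (induction n arbitrary: s)
    case 0
    then have same: "s(x := 0, y := s y + 0, t := s t + 0) = s" by auto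
    show ?case unfolding same by (rule exec.loop_end) (rule 0)
  next
    case (Suc n)
    let ?s = "s(x := n, y := Suc (s y), t := Suc (s t))"
    have "exec (INC y ;; INC t) (s(x := n)) ?s"
      using exec.seq[OF exec.inc[where r = y and s = "s(x := n)"] exec.inc[where r = t]] assms by simp
    moreover have "exec (LOOP x (INC y ;; INC t)) ?s
        (?s(x := 0, y := ?s y + n, t := ?s t + n))"
      by (rule Suc.IH) (use assms in simp)
    moreover have "?s(x := 0, y := ?s y + n, t := ?s t + n)
        = s(x := 0, y := s y + Suc n, t := s t + Suc n)"
      using assms by (auto simp: fun_eq_iff)
    ultimately show ?case using exec.loop_step[where s = s, OF Suc.prems] by metis
  qed
  have restore: "exec (LOOP t (INC x)) s (s(t := 0, x := s x + n))" if "s t = n" for n s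
    using that
  proof (induction n arbitrary: s)
    case 0
    then have same: "s(t := 0, x := s x + 0) = s" by auto
    show ?case unfolding same by (rule exec.loop_end) (rule 0)
  next
    case (Suc n)
    let ?s = "s(t := n, x := Suc (s x))"
    have "exec (INC x) (s(t := n)) ?s"
      using exec.inc[where r = x and s = "s(t := n)"] assms by simp
    moreover have "exec (LOOP t (INC x)) ?s (?s(t := 0, x := ?s x + n))"
      by (rule Suc.IH) (use assms in simp)
    moreover have "?s(t := 0, x := ?s x + n) = s(t := 0, x := s x + Suc n)"
      using assms by (auto simp: fun_eq_iff)
    ultimately show ?case using exec.loop_step[where s = s, OF Suc.prems] by metis
  qed
  let ?a = "s(y := 0, t := 0)"
  let ?b = "?a(x := 0, y := ?a y + s x, t := ?a t + s x)"
  let ?c = "?b(t := 0, x := ?b x + s x)"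
  have "exec (copy x y t) s ?c"
    unfolding copy_def
  proof (intro exec.seq[OF exec_clear] exec.seq)
    show "exec (LOOP x (INC y ;; INC t)) ?a ?b"
      by (rule spread) (use assms in simp)
    show "exec (LOOP t (INC x)) ?b ?c"
      by (rule restore) (use assms in simp)
  qed
  moreover have "?c = s(y := s x, t := 0)"
    using assms by (auto simp: fun_eq_iff)
  ultimately show ?thesis by simp
qed

inductive_cases computes_ZeroE: "computes Zero xs y"
inductive_cases computes_SuccE: "computes Succ xs y"
inductive_cases computes_ProjE: "computes (Proj i) xs y"
inductive_cases computes_CompE: "computes (Comp f gs) xs y"
inductive_cases computes_PrimRecE: "computes (PrimRec f g) xs y"
inductive_cases computes_PrimRec_0E: "computes (PrimRec f g) (0 # xs) y"
inductive_cases computes_PrimRec_SucE: "computes (PrimRec f g) (Suc n # xs) y"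
inductive_cases computes_MuE: "computes (Mu f) xs y"

text \<open>\<open>computes\<close> unfolds a recursion from the last value down, whereas the
  compiled loop works upwards from 0. The sequence \<open>Y\<close> of intermediate values serves as
  the invariant of that loop.\<close>

lemma computes_PrimRec_trace:
  assumes "computes (PrimRec f g) (n # xs) y"
  obtains Y where "Y n = y" "computes f xs (Y 0)"
    "\<And>m. m < n \<Longrightarrow> computes g (m # Y m # xs) (Y (Suc m))"
proof -
  have "\<exists>Y. Y n = y \<and> computes f xs (Y 0) \<and> (\<forall>m<n. computes g (m # Y m # xs) (Y (Suc m)))"
    using assms
  proof (induction n arbitrary: y)
    case 0
    then show ?case by (auto elim!: computes_PrimRec_0E intro: exI[of _ "\<lambda>_. y"])
  next
    case (Suc n)
    from Suc.prems obtain z where z: "computes (PrimRec f g) (n # xs) z" "computes g (n # z # xs) y"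
      by (rule computes_PrimRec_SucE)
    from Suc.IH[OF z(1)] obtain Y where Y: "Y n = z" "computes f xs (Y 0)"
      "\<forall>m<n. computes g (m # Y m # xs) (Y (Suc m))"
      by blast
    have "computes g (m # (Y(Suc n := y)) m # xs) ((Y(Suc n := y)) (Suc m))" if "m < Suc n" for m
      using Y z(2) that by (cases "m = n") auto
    then show ?case using Y by (intro exI[of _ "Y(Suc n := y)"]) auto
  qed
  then show ?thesis using that by blast
qed

definition implements :: "com \<Rightarrow> nat \<Rightarrow> nat \<Rightarrow> nat \<Rightarrow> (nat \<Rightarrow> nat) \<Rightarrow> bool" where
  "implements c out y k s \<longleftrightarrow> (\<exists>t. exec c s t \<and> t out = y \<and> (\<forall>r<k. r \<noteq> out \<longrightarrow> t r = s r))"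

lemma implementsI:
  assumes "exec c s t" "t out = y" "\<And>r. r < k \<Longrightarrow> r \<noteq> out \<Longrightarrow> t r = s r"
  shows "implements c out y k s"
  using assms unfolding implements_def by blast

text \<open>Nothing is claimed where \<open>f\<close> has no value. This suffices, because the
  diagonal argument runs the compiled program only on an input where it has one.\<close>

definition compiles :: "recfun \<Rightarrow> bool" where
  "compiles f \<longleftrightarrow> (\<forall>s ins out k y. computes f (map s ins) y \<longrightarrow> (\<forall>i\<in>set ins. i < k) \<longrightarrow>
     out < k \<longrightarrow> out \<notin> set ins \<longrightarrow> implements (compile f ins out k) out y k s)"

lemma compilesD:
  assumes "compiles f" "computes f (map s ins) y" "\<And>i. i \<in> set ins \<Longrightarrow> i < k" "out < k"
    "out \<notin> set ins"
  obtains t where "exec (compile f ins out k) s t" "t out = y"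
    "\<And>r. r < k \<Longrightarrow> r \<noteq> out \<Longrightarrow> t r = s r"
  using assms unfolding compiles_def implements_def by metis

text \<open>The arguments lie below \<open>k\<close> and the results are stored from
  \<open>k\<close> on, so each call finds the original arguments; scratch starts at
  \<open>b\<close>, beyond all results, so later calls keep the earlier ones.\<close>

lemma exec_compile_list:
  assumes "\<And>g. g \<in> set gs \<Longrightarrow> compiles g" "list_all2 (\<lambda>g y. computes g (map s ins) y) gs ys"
    "\<And>i. i \<in> set ins \<Longrightarrow> i < k" "k + length gs \<le> b"
  shows "\<exists>t. exec (compile_list gs ins k b) s t \<and> map t [k..<k + length gs] = ys \<and>
    (\<forall>r<k. t r = s r)"
  using assms
proof (induction gs arbitrary: s k ys)
  case Nil
  then show ?case by (auto intro: exec.skip)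
next
  case (Cons g gs)
  from Cons.prems(2) obtain y ys' where ys: "ys = y # ys'" "computes g (map s ins) y"
    "list_all2 (\<lambda>g y. computes g (map s ins) y) gs ys'"
    by (auto simp: list_all2_Cons1)
  have g: "compiles g" using Cons.prems(1) by simp
  have ins: "i < b" if "i \<in> set ins" for i using Cons.prems(3)[OF that] Cons.prems(4) by simp
  have k: "k < b" "k \<notin> set ins" using Cons.prems(3)[of k] Cons.prems(4) by auto
  obtain t where t: "exec (compile g ins k b) s t" "t k = y"
    "\<And>r. r < b \<Longrightarrow> r \<noteq> k \<Longrightarrow> t r = s r"
    by (rule compilesD[OF g ys(2) ins k]) auto
  have same: "map t ins = map s ins"
    using t(3) Cons.prems(3,4) by fastforce
  note rest = ys(3)[folded same]
  have "\<exists>u. exec (compile_list gs ins (Suc k) b) t u \<and> map u [Suc k..<Suc k + length gs] = ys' \<and>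
    (\<forall>r<Suc k. u r = t r)"
    by (rule Cons.IH) (use Cons.prems rest in \<open>auto simp: less_Suc_eq\<close>)
  then obtain u where u: "exec (compile_list gs ins (Suc k) b) t u"
    "map u [Suc k..<Suc k + length gs] = ys'" "\<forall>r<Suc k. u r = t r"
    by blast
  have "[k..<k + length (g # gs)] = k # [Suc k..<Suc k + length gs]"
    by (simp add: upt_conv_Cons del: upt_Suc)
  then have "map u [k..<k + length (g # gs)] = ys"
    using u t ys by simp
  moreover have "\<forall>r<k. u r = s r" using u t Cons.prems(4) by auto
  ultimately show ?case using exec.seq[OF t(1) u(1)] by auto
qed

lemma compiles_all: "compiles f"
proof (induction f)
  case Zero
  have "implements (compile Zero ins out k) out 0 k s" for s out k and ins :: "nat list"
    by (rule implementsI[where t = "s(out := 0)"]) (auto simp: exec_clear)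
  then show ?case unfolding compiles_def by (auto elim!: computes_ZeroE)
next
  case Succ
  show ?case unfolding compiles_def
  proof (intro allI impI)
    fix s :: "nat \<Rightarrow> nat" and ins out k y
    assume *: "computes Succ (map s ins) y" "\<forall>i\<in>set ins. i < k" "out < k" "out \<notin> set ins"
    then obtain x where x: "ins = [x]" "y = Suc (s x)"
      by (auto elim!: computes_SuccE simp: map_eq_Cons_conv)
    let ?t = "s(out := s x, k := 0)"
    have "exec (compile Succ ins out k) s (?t(out := Suc (?t out)))"
      unfolding compile.simps x list.sel
      by (rule exec.seq[OF exec_copy exec.inc]) (use x * in auto)
    then show "implements (compile Succ ins out k) out y k s"
      by (rule implementsI) (use x * in auto)
  qed
next
  case (Proj i)
  show ?case unfolding compiles_def
  proof (intro allI impI)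
    fix s :: "nat \<Rightarrow> nat" and ins out k y
    assume *: "computes (Proj i) (map s ins) y" "\<forall>i\<in>set ins. i < k" "out < k" "out \<notin> set ins"
    then have i: "i < length ins" "y = s (ins ! i)"
      by (auto elim!: computes_ProjE)
    then have "ins ! i < k" "ins ! i \<noteq> out"
      using * nth_mem by blast+
    then have "exec (compile (Proj i) ins out k) s (s(out := y, k := 0))"
      using i *(3) by (auto intro!: exec_copy)
    then show "implements (compile (Proj i) ins out k) out y k s"
      by (rule implementsI) (use * in auto)
  qed
next
  case (Comp f gs)
  show ?case unfolding compiles_def
  proof (intro allI impI)
    fix s :: "nat \<Rightarrow> nat" and ins out k y
    let ?b = "k + length gs"
    assume *: "computes (Comp f gs) (map s ins) y" "\<forall>i\<in>set ins. i < k" "out < k" "out \<notin> set ins"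
    from *(1) obtain ys where ys: "list_all2 (\<lambda>g y. computes g (map s ins) y) gs ys"
      "computes f ys y"
      by (rule computes_CompE)
    have "\<exists>t. exec (compile_list gs ins k ?b) s t \<and> map t [k..<?b] = ys \<and> (\<forall>r<k. t r = s r)"
      by (rule exec_compile_list) (use Comp.IH(2) ys(1) *(2) in auto)
    then obtain t where t: "exec (compile_list gs ins k ?b) s t" "map t [k..<?b] = ys"
      "\<forall>r<k. t r = s r"
      by blast
    obtain u where u: "exec (compile f [k..<?b] out ?b) t u" "u out = y"
      "\<And>r. r < ?b \<Longrightarrow> r \<noteq> out \<Longrightarrow> u r = t r"
      by (rule compilesD[OF Comp.IH(1), of t "[k..<?b]" y ?b out]) (use t(2) ys(2) *(3) in auto)
    show "implements (compile (Comp f gs) ins out k) out y k s"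
      using exec.seq[OF t(1) u(1)] u t(3) by (intro implementsI[of _ s u]) auto
  qed
next
  case (PrimRec f g)
  show ?case unfolding compiles_def
  proof (intro allI impI)
    fix s :: "nat \<Rightarrow> nat" and ins out k y
    assume *: "computes (PrimRec f g) (map s ins) y" "\<forall>i\<in>set ins. i < k" "out < k"
      "out \<notin> set ins"
    from *(1) obtain x xs where ins: "ins = x # xs"
      by (cases ins) (auto elim: computes_PrimRecE)
    from *(1) obtain Y where Y: "Y (s x) = y" "computes f (map s xs) (Y 0)"
      "\<And>m. m < s x \<Longrightarrow> computes g (m # Y m # map s xs) (Y (Suc m))"
      unfolding ins by (auto elim: computes_PrimRec_trace)
    have "x < k" using *(2) ins by simp
    have xs: "i < k" if "i \<in> set xs" for i using that *(2) ins by simp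
    let ?body = "compile g ((k + 1) # (k + 2) # xs) (k + 3) (k + 4) ;;
       copy (k + 3) (k + 2) (k + 4) ;; INC (k + 1)"
    \<comment> \<open>Invariant: \<open>m\<close> rounds are done, \<open>d\<close> remain, and the
      accumulator holds \<open>Y m\<close>.\<close>
    have loop: "\<exists>u. exec (LOOP k ?body) t u \<and> u (k + 2) = y \<and> (\<forall>r<k. u r = s r)"
      if "t k = d" "t (k + 1) = m" "t (k + 2) = Y m" "m + d = s x" "\<forall>r<k. t r = s r" for t d m
      using that
    proof (induction d arbitrary: t m)
      case 0
      then show ?case using Y(1) by (intro exI[of _ t]) (auto intro: exec.loop_end)
    next
      case (Suc d)
      let ?t = "t(k := d)"
      have args: "map ?t ((k + 1) # (k + 2) # xs) = m # Y m # map s xs"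
        using Suc.prems by (auto dest!: xs)
      have "m < s x" using Suc.prems(4) by simp
      note call = Y(3)[OF this, folded args]
      obtain u where u: "exec (compile g ((k + 1) # (k + 2) # xs) (k + 3) (k + 4)) ?t u"
        "u (k + 3) = Y (Suc m)" "\<And>r. r < k + 4 \<Longrightarrow> r \<noteq> k + 3 \<Longrightarrow> u r = ?t r"
        by (rule compilesD[OF PrimRec.IH(2) call, of "k + 4" "k + 3"]) (auto dest!: xs)
      let ?v = "u(k + 2 := u (k + 3), k + 4 := 0)"
      let ?w = "?v(k + 1 := Suc (?v (k + 1)))"
      have body: "exec ?body ?t ?w"
        by (intro exec.seq[OF u(1)] exec.seq[OF exec_copy] exec.inc) auto
      have "\<exists>z. exec (LOOP k ?body) ?w z \<and> z (k + 2) = y \<and> (\<forall>r<k. z r = s r)"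
        by (rule Suc.IH[of _ "Suc m"]) (use u Suc.prems in auto)
      then show ?case using exec.loop_step[where s = t, OF Suc.prems(1) body] by blast
    qed
    obtain t where t: "exec (compile f xs (k + 2) (k + 3)) s t" "t (k + 2) = Y 0"
      "\<And>r. r < k + 3 \<Longrightarrow> r \<noteq> k + 2 \<Longrightarrow> t r = s r"
      by (rule compilesD[OF PrimRec.IH(1) Y(2), of "k + 3" "k + 2"]) (auto dest!: xs)
    let ?u = "(t(k := t x, k + 3 := 0))(k + 1 := 0)"
    have "\<exists>v. exec (LOOP k ?body) ?u v \<and> v (k + 2) = y \<and> (\<forall>r<k. v r = s r)"
      by (rule loop[of _ "s x" 0]) (use t \<open>x < k\<close> in auto)
    then obtain v where v: "exec (LOOP k ?body) ?u v" "v (k + 2) = y" "\<forall>r<k. v r = s r"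
      by blast
    have "exec (compile (PrimRec f g) ins out k) s (v(out := v (k + 2), k + 3 := 0))"
      unfolding compile.simps ins list.sel
      by (intro exec.seq[OF t(1)] exec.seq[OF exec_copy] exec.seq[OF exec_clear]
          exec.seq[OF v(1)] exec_copy) (use \<open>x < k\<close> *(3) in auto)
    then show "implements (compile (PrimRec f g) ins out k) out y k s"
      by (rule implementsI) (use v *(3) in auto)
  qed
next
  case (Mu f)
  show ?case unfolding compiles_def
  proof (intro allI impI)
    fix s :: "nat \<Rightarrow> nat" and ins out k n
    assume *: "computes (Mu f) (map s ins) n" "\<forall>i\<in>set ins. i < k" "out < k" "out \<notin> set ins"
    from *(1) have n: "computes f (n # map s ins) 0"
      "\<forall>m<n. \<exists>y. computes f (m # map s ins) (Suc y)"
      by (auto elim: computes_MuE)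
    let ?c = "compile f (k # ins) (k + 1) (k + 2)"
    have call: "\<exists>u. exec ?c t u \<and> u (k + 1) = y \<and> u k = m \<and> (\<forall>r<k. u r = s r)"
      if "t k = m" "\<forall>r<k. t r = s r" "computes f (m # map s ins) y" for t m y
    proof -
      have args: "map t (k # ins) = m # map s ins" using that *(2) by auto
      note f = that(3)[folded args]
      obtain u where "exec ?c t u" "u (k + 1) = y"
        "\<And>r. r < k + 2 \<Longrightarrow> r \<noteq> k + 1 \<Longrightarrow> u r = t r"
        by (rule compilesD[OF Mu.IH f, of "k + 2" "k + 1"])
          (use *(2) in auto)
      then show ?thesis using that by (intro exI[of _ u]) auto
    qed
    \<comment> \<open>Invariant: \<open>k\<close> holds the candidate \<open>m\<close>,
      \<open>k + 1\<close> holds the value of \<open>f\<close> at \<open>m\<close>, and the sought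
      zero \<open>n\<close> is \<open>d\<close> candidates away.\<close>
    have loop: "\<exists>u. exec (LOOP (k + 1) (INC k ;; ?c)) t u \<and> u k = n \<and> (\<forall>r<k. u r = s r)"
      if "computes f (m # map s ins) (t (k + 1))" "t k = m" "m + d = n" "\<forall>r<k. t r = s r" for t m d
      using that
    proof (induction d arbitrary: t m)
      case 0
      then have "t (k + 1) = 0" using n(1) computes_deterministic by auto
      then show ?case using 0 by (intro exI[of _ t]) (auto intro: exec.loop_end)
    next
      case (Suc d)
      then have "m < n" by simp
      then obtain y where "computes f (m # map s ins) (Suc y)" using n(2) by blast
      \<comment> \<open>By determinism the stored value is the positive one, so the loop goes on.
        Its decrement of \<open>k + 1\<close> is harmless, since the next call overwrites that
        register.\<close>
      then have y: "t (k + 1) = Suc y" using Suc.prems(1) computes_deterministic by blast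
      let ?t = "t(k + 1 := y)"
      let ?u = "?t(k := Suc (?t k))"
      \<comment> \<open>The next candidate is either \<open>n\<close>, where the value is 0, or
        below \<open>n\<close>, where it is positive.\<close>
      obtain z where z: "computes f (Suc m # map s ins) z"
        using n \<open>m < n\<close> by (cases "Suc m = n") (blast, metis Suc_lessI)
      have "\<exists>v. exec ?c ?u v \<and> v (k + 1) = z \<and> v k = Suc m \<and> (\<forall>r<k. v r = s r)"
        by (rule call[OF _ _ z]) (use Suc.prems in auto)
      then obtain v where v: "exec ?c ?u v" "v (k + 1) = z" "v k = Suc m" "\<forall>r<k. v r = s r"
        by blast
      have "\<exists>w. exec (LOOP (k + 1) (INC k ;; ?c)) v w \<and> w k = n \<and> (\<forall>r<k. w r = s r)"
        by (rule Suc.IH[of "Suc m"]) (use v z Suc.prems(3) in auto)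
      then show ?case
        using exec.loop_step[where s = t, OF y exec.seq[OF exec.inc v(1)]] by blast
    qed
    obtain z where z: "computes f (0 # map s ins) z"
      using n by (cases "n = 0") auto
    have "\<exists>u. exec ?c (s(k := 0)) u \<and> u (k + 1) = z \<and> u k = 0 \<and> (\<forall>r<k. u r = s r)"
      by (rule call[OF _ _ z]) auto
    then obtain u where u: "exec ?c (s(k := 0)) u" "u (k + 1) = z" "u k = 0" "\<forall>r<k. u r = s r"
      by blast
    have "\<exists>v. exec (LOOP (k + 1) (INC k ;; ?c)) u v \<and> v k = n \<and> (\<forall>r<k. v r = s r)"
      by (rule loop[of 0 _ n]) (use u z in auto)
    then obtain v where v: "exec (LOOP (k + 1) (INC k ;; ?c)) u v" "v k = n" "\<forall>r<k. v r = s r"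
      by blast
    have "exec (compile (Mu f) ins out k) s (v(out := v k, k + 2 := 0))"
      unfolding compile.simps
      by (rule exec.seq[OF exec_clear] exec.seq[OF u(1)] exec.seq[OF v(1)] exec_copy)+
        (use *(3) in auto)
    then show "implements (compile (Mu f) ins out k) out n k s"
      by (rule implementsI) (use v *(3) in auto)
  qed
qed

section \<open>Counter machines on a translucent tape\<close>

lemma kstar_Nil: "[] \<in> kstar X"
  unfolding kstar_def by (force intro: image_eqI[of _ _ "[]"])

lemma kstar_append: "x \<in> kstar X \<Longrightarrow> y \<in> kstar X \<Longrightarrow> x @ y \<in> kstar X"
  unfolding kstar_def by (force intro: image_eqI[of _ _ "xs @ ys" for xs ys])

lemma kstar_word: "x \<in> X \<Longrightarrow> x \<in> kstar X"
  unfolding kstar_def by (rule image_eqI[of _ _ "[x]"]) auto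

lemma kstar_mono: "X \<subseteq> Y \<Longrightarrow> kstar X \<subseteq> kstar Y"
  unfolding kstar_def by (intro image_mono lists_mono)

lemma kstar_induct [consumes 1, case_names Nil word]:
  assumes "w \<in> kstar X" "P []" "\<And>x w. x \<in> X \<Longrightarrow> w \<in> kstar X \<Longrightarrow> P w \<Longrightarrow> P (x @ w)"
  shows "P w"
proof -
  obtain xs where "xs \<in> lists X" "w = concat xs"
    using assms(1) unfolding kstar_def by blast
  then show ?thesis
  proof (induction xs arbitrary: w)
    case (Cons x xs)
    then have "concat xs \<in> kstar X" unfolding kstar_def by auto
    with Cons show ?case by (auto intro: assms(3))
  qed (simp add: assms(2))
qed

lemma kstar_cases [consumes 1, case_names Nil word]:
  assumes "w \<in> kstar X"
  obtains "w = []" | x w' where "x \<in> X" "w' \<in> kstar X" "w = x @ w'"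
  using assms by (induction rule: kstar_induct) auto

lemma kstar_lists: "w \<in> kstar X \<Longrightarrow> X \<subseteq> lists S \<Longrightarrow> w \<in> lists S"
  by (induction rule: kstar_induct) auto

text \<open>\<open>Stop r\<close> has no rule in \<open>mstep\<close>: the machine halts there, and
  the halt counts as accepting when register \<open>r\<close> is zero. In \<open>Dec\<close> the
  second label is the exit for a zero register.\<close>

datatype instr = Start nat | Stop nat | Load nat | Inc nat nat | Dec nat nat nat

text \<open>
  \<open>Start\<close> and \<open>Load\<close> are blocked in most configurations, exactly where their sparse sets of
  translucent words block the automaton: \<open>Start\<close> requires all registers to be zero, and \<open>Load\<close>
  increments register 0 while all others are zero. The single translucent word of a \<open>Load\<close>
  state keeps the entries for the input-dependent states independent of the number of registers.
\<close>

inductive mstep :: "(nat \<times> instr) set \<Rightarrow> nat \<times> (nat \<Rightarrow> nat) \<Rightarrow> nat \<times> (nat \<Rightarrow> nat) \<Rightarrow> bool"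
  for P where
  start: "(q, Start q') \<in> P \<Longrightarrow> mstep P (q, \<lambda>_. 0) (q', \<lambda>_. 0)"
| load: "(q, Load q') \<in> P \<Longrightarrow> (\<And>j. j \<noteq> 0 \<Longrightarrow> s j = 0) \<Longrightarrow>
    mstep P (q, s) (q', s(0 := Suc (s 0)))"
| inc: "(q, Inc r q') \<in> P \<Longrightarrow> mstep P (q, s) (q', s(r := Suc (s r)))"
| dec: "(q, Dec r q' q'') \<in> P \<Longrightarrow> s r = Suc n \<Longrightarrow> mstep P (q, s) (q', s(r := n))"
| zero: "(q, Dec r q' q'') \<in> P \<Longrightarrow> s r = 0 \<Longrightarrow> mstep P (q, s) (q'', s)"

text \<open>Odd numbers for tokens and positive even ones for seals leave 0 for the end
  marker.\<close>

definition token :: "nat \<Rightarrow> nat" where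
  "token j = 2 * j + 1"

definition seal :: "nat \<Rightarrow> nat" where
  "seal j = 2 * j + 2"

lemma token_seal [simp]: "token i = token j \<longleftrightarrow> i = j" "seal i = seal j \<longleftrightarrow> i = j"
  "token i \<noteq> seal j" "seal j \<noteq> token i" "token i \<noteq> 0" "0 \<noteq> token i" "seal i \<noteq> 0" "0 \<noteq> seal i"
  unfolding token_def seal_def by presburger+

definition letters :: "nat \<Rightarrow> nat set" where
  "letters R = token ` {..<R} \<union> seal ` {..<R}"

definition singles :: "nat set \<Rightarrow> nat list set" where
  "singles J = (\<lambda>j. [token j]) ` J"

definition blocks :: "nat \<Rightarrow> nat list set" where
  "blocks R = (\<lambda>j. [seal j, token j]) ` {..<R}"

fun words :: "nat \<Rightarrow> instr \<Rightarrow> nat list set" where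
  "words R (Start q) = blocks R"
| "words R (Stop r) = singles ({..<R} - {r}) \<union> blocks R"
| "words R (Load q) = singles {0}"
| "words R (Inc r q) = singles {..<R}"
| "words R (Dec r q q') = singles ({..<R} - {r}) \<union> blocks R"

text \<open>These are table entries in the format of a listing: a letter or the marker 0, then 0 for
  acceptance or a target shifted by 2.\<close>

fun moves :: "instr \<Rightarrow> (nat \<times> nat) set" where
  "moves (Start q) = {(0, q + 2)}"
| "moves (Stop r) = {(0, 0)}"
| "moves (Load q) = {(seal 0, q + 2)}"
| "moves (Inc r q) = {(seal r, q + 2)}"
| "moves (Dec r q q') = {(token r, q + 2), (0, q' + 2)}"

text \<open>The labels are the states. The existential form avoids choosing the instruction at a
  label; it is resolved by \<open>transl_aut\<close> and \<open>delta_aut\<close> once labels are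
  unique.\<close>

definition aut :: "nat \<Rightarrow> (nat \<times> instr) set \<Rightarrow> (nat, nat) automaton" where
  "aut R P = \<lparr>states = fst ` P, alphabet = letters R, marker = 0,
     transl = (\<lambda>q. {x. \<exists>i. (q, i) \<in> P \<and> x \<in> words R i}), initials = {0},
     delta = (\<lambda>q a. if \<exists>i. (q, i) \<in> P \<and> (a, 0) \<in> moves i then Acc
       else Goto {q'. \<exists>i. (q, i) \<in> P \<and> (a, q' + 2) \<in> moves i})\<rparr>"

fun registers :: "instr \<Rightarrow> nat set" where
  "registers (Start q) = {}"
| "registers (Stop r) = {r}"
| "registers (Load q) = {0}"
| "registers (Inc r q) = {r}"
| "registers (Dec r q q') = {r}"

fun targets :: "instr \<Rightarrow> nat set" where
  "targets (Start q) = {q}"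
| "targets (Stop r) = {}"
| "targets (Load q) = {q}"
| "targets (Inc r q) = {q}"
| "targets (Dec r q q') = {q, q'}"

text \<open>Only the counts matter, not the order of the tokens. Registers from \<open>R\<close> on
  are forced to be zero.\<close>

definition tokens :: "nat \<Rightarrow> (nat \<Rightarrow> nat) \<Rightarrow> nat list \<Rightarrow> bool" where
  "tokens R s u \<longleftrightarrow> set u \<subseteq> token ` {..<R} \<and> (\<forall>j. count_list u (token j) = s j)"

definition tape :: "nat \<Rightarrow> (nat \<Rightarrow> nat) \<Rightarrow> nat list \<Rightarrow> bool" where
  "tape R s w \<longleftrightarrow> (\<exists>u v. w = u @ v \<and> tokens R s u \<and> v \<in> kstar (blocks R))"

section \<open>Parsing the tape\<close>

lemma kstar_singles: "w \<in> kstar (singles J) \<longleftrightarrow> set w \<subseteq> token ` J"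
proof
  show "w \<in> kstar (singles J) \<Longrightarrow> set w \<subseteq> token ` J"
    by (induction rule: kstar_induct) (auto simp: singles_def)
  show "set w \<subseteq> token ` J \<Longrightarrow> w \<in> kstar (singles J)"
  proof (induction w)
    case (Cons a w)
    then have "[a] \<in> kstar (singles J)" by (intro kstar_word) (auto simp: singles_def)
    from kstar_append[OF this] Cons show ?case by auto
  qed (rule kstar_Nil)
qed

lemma kstar_tokens_blocks:
  assumes "set u \<subseteq> token ` J" "v \<in> kstar (blocks R)"
  shows "u @ v \<in> kstar (singles J \<union> blocks R)"
  using assms kstar_append kstar_singles kstar_mono[of "singles J" "singles J \<union> blocks R"]
    kstar_mono[of "blocks R" "singles J \<union> blocks R"] by blast

text \<open>A block begins with a seal, so a leading token can only be consumed as a word of length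
  one.\<close>

lemma tokens_parsed:
  assumes "set u \<subseteq> range token" "u @ v \<in> kstar (singles J \<union> blocks R)"
  shows "set u \<subseteq> token ` J"
  using assms
proof (induction u)
  case (Cons a u)
  from Cons.prems(2) show ?case
  proof (cases rule: kstar_cases)
    case (word x w)
    then show ?thesis using Cons by (auto simp: singles_def blocks_def)
  qed simp
qed simp

text \<open>The first seal on the tape ends the free tokens. Hence a seal reached across tokens only
  is that of the first block, and its own token follows it.\<close>

lemma sealed_parsed:
  assumes "set u \<subseteq> range token" "v \<in> kstar (blocks R)" "set x \<subseteq> range token"
    "x @ seal r # y = u @ v"
  obtains v' where "x = u" "y = token r # v'" "v' \<in> kstar (blocks R)" "r < R"
proof -
  have "x = u \<and> (\<exists>v'. y = token r # v' \<and> v' \<in> kstar (blocks R) \<and> r < R)"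
    using assms(1,3,4)
  proof (induction u arbitrary: x)
    case Nil
    from assms(2) show ?case
    proof (cases rule: kstar_cases)
      case (word z v')
      then show ?thesis using Nil by (cases x) (auto simp: blocks_def)
    qed (use Nil in simp)
  next
    case (Cons a u)
    then show ?case by (cases x) auto
  qed
  with that show ?thesis by blast
qed

text \<open>A seal can only be consumed together with its token, so a parse of intact blocks never
  stops in front of a token.\<close>

lemma token_not_in_blocks:
  assumes "v \<in> kstar (blocks R)" "x \<in> kstar (singles J \<union> blocks R)"
  shows "x @ token r # y \<noteq> v"
  using assms
proof (induction arbitrary: x rule: kstar_induct)
  case (word b v)
  from word.prems show ?case
  proof (cases rule: kstar_cases)
    case Nil
    then show ?thesis using word.hyps(1) by (auto simp: blocks_def)
  next
    case (word z x')
    then show ?thesis using word.IH[OF word(2)] \<open>b \<in> blocks R\<close>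
      by (auto simp: blocks_def singles_def)
  qed
qed simp

text \<open>A token that is read must be free, so a decrement leaves the blocks intact.\<close>

lemma token_parsed:
  assumes "set u \<subseteq> range token" "v \<in> kstar (blocks R)" "x \<in> kstar (singles J \<union> blocks R)"
    "x @ token r # y = u @ v"
  obtains u' where "set x \<subseteq> token ` J" "u = x @ token r # u'" "y = u' @ v"
proof -
  have "set x \<subseteq> token ` J \<and> (\<exists>u'. u = x @ token r # u' \<and> y = u' @ v)"
    using assms(1,3,4)
  proof (induction u arbitrary: x)
    case Nil
    then show ?case using token_not_in_blocks[OF assms(2)] by fastforce
  next
    case (Cons a u)
    from Cons.prems(2) show ?case
    proof (cases rule: kstar_cases)
      case Nil
      then show ?thesis using Cons.prems by auto
    next
      case (word z x')
      then obtain j where "z = [token j]" "j \<in> J" "a = token j"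
        using Cons.prems by (auto simp: singles_def blocks_def)
      then show ?thesis using Cons.IH[OF _ word(2)] Cons.prems word(3) by auto
    qed
  qed
  with that show ?thesis by blast
qed

lemma tokens_zero: "tokens R (\<lambda>_. 0) u \<longleftrightarrow> u = []"
  unfolding tokens_def
  by (cases u) auto

lemma tokens_snoc: "tokens R s u \<Longrightarrow> r < R \<Longrightarrow> tokens R (s(r := Suc (s r))) (u @ [token r])"
  unfolding tokens_def by auto

lemma tokens_remove:
  "tokens R s (x @ token r # y) \<Longrightarrow> s r = Suc n \<Longrightarrow> tokens R (s(r := n)) (x @ y)"
  unfolding tokens_def by (auto split: if_splits)

lemma tokens_range: "tokens R s u \<Longrightarrow> set u \<subseteq> range token"
  unfolding tokens_def by blast

lemma tokens_avoid:
  assumes "tokens R s u" "\<And>j. j \<notin> J \<Longrightarrow> s j = 0"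
  shows "set u \<subseteq> token ` (J \<inter> {..<R})"
proof
  fix a assume a: "a \<in> set u"
  then obtain j where j: "j < R" "a = token j" using assms(1) by (auto simp: tokens_def)
  then have "s j \<noteq> 0" using a assms(1) count_list_0_iff by (metis tokens_def)
  then have "j \<in> J" using assms(2) by metis
  then show "a \<in> token ` (J \<inter> {..<R})" using j by simp
qed

lemma tokens_absent: "tokens R s u \<Longrightarrow> token j \<notin> set u \<Longrightarrow> s j = 0"
  unfolding tokens_def using count_list_0_iff by metis

lemma blocks_letters: "v \<in> kstar (blocks R) \<Longrightarrow> v \<in> lists (letters R)"
  by (erule kstar_lists) (auto simp: blocks_def letters_def)

lemma tokens_letters: "tokens R s u \<Longrightarrow> u \<in> lists (letters R)"
  by (auto simp: tokens_def letters_def)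

text \<open>Label 0 is the initial state. The \<open>Start\<close> there rejects every tape that is
  not a sequence of blocks, and the simulation rests on this.\<close>

locale program =
  fixes R :: nat and P :: "(nat \<times> instr) set"
  assumes finite_P: "finite P"
    and functional: "(q, i) \<in> P \<Longrightarrow> (q, j) \<in> P \<Longrightarrow> i = j"
    and start_label: "\<exists>q. (0, Start q) \<in> P"
    and registers_bound: "(q, i) \<in> P \<Longrightarrow> registers i \<subseteq> {..<R}"
    and targets_closed: "(q, i) \<in> P \<Longrightarrow> targets i \<subseteq> fst ` P"
begin

abbreviation A :: "(nat, nat) automaton" where
  "A \<equiv> aut R P"

lemma aut_sel [simp]: "states A = fst ` P" "alphabet A = letters R" "marker A = 0"
  "initials A = {0}"
  unfolding aut_def by auto

lemma transl_aut: "(q, i) \<in> P \<Longrightarrow> transl A q = words R i"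
  unfolding aut_def using functional by auto

lemma delta_aut: "(q, i) \<in> P \<Longrightarrow>
    delta A q a = (if (a, 0) \<in> moves i then Acc else Goto {q'. (a, q' + 2) \<in> moves i})"
proof -
  assume i: "(q, i) \<in> P"
  then have *: "(\<exists>i. (q, i) \<in> P \<and> x \<in> moves i) \<longleftrightarrow> x \<in> moves i" for x
    using functional by blast
  show ?thesis unfolding aut_def by (simp add: *)
qed

lemma state: "q \<in> states A \<Longrightarrow> \<exists>i. (q, i) \<in> P"
  by auto

lemma zero_not_letter: "0 \<notin> letters R"
  unfolding letters_def by auto

lemma readable_aut: "(q, i) \<in> P \<Longrightarrow> readable A q = {a \<in> letters R. \<exists>c. (a, c) \<in> moves i}"
  unfolding readable_def using zero_not_letter by (cases i) (auto simp: delta_aut)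

lemma finite_letters: "finite (letters R)"
  unfolding letters_def by simp

lemma prefix_code_words: "prefix_code (words R i)"
  by (cases i) (auto simp: prefix_code_def singles_def blocks_def strict_prefix_def)

text \<open>Each instruction has at most one move per letter. Instructions that read a seal have
  only tokens as translucent words; \<open>Dec r\<close> reads \<open>token r\<close>, while its
  words begin with seals or other tokens; \<open>Start\<close> and \<open>Stop\<close> read no
  letter.\<close>

lemma rdfawtw_aut: "rdfawtw A"
proof -
  have move_target: "q' \<in> states A" if "(q, i) \<in> P" "(a, q' + 2) \<in> moves i" for q i a q'
    using targets_closed[OF that(1)] that(2) by (cases i) auto
  have init: "0 \<in> states A" using start_label by force
  have letter: "\<exists>S. S \<subseteq> states A \<and> delta A q a = Goto S" if "q \<in> states A" "a \<in> alphabet A" for q a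
  proof -
    from state[OF that(1)] obtain i where i: "(q, i) \<in> P" by blast
    have "a \<noteq> 0" using that(2) zero_not_letter by (metis aut_sel(2))
    then have "(a, 0) \<notin> moves i" by (cases i) auto
    then show ?thesis using delta_aut[OF i] move_target[OF i] by auto
  qed
  have goto: "S \<subseteq> states A" "card S \<le> 1" if "q \<in> states A" "delta A q a = Goto S" for q a S
  proof -
    from state[OF that(1)] obtain i where i: "(q, i) \<in> P" by blast
    have S: "S = {q'. (a, q' + 2) \<in> moves i}"
      using that(2) delta_aut[OF i] by (auto split: if_splits)
    have "x = y" if "x \<in> S" "y \<in> S" for x y
      using that unfolding S by (cases i) auto
    then have "card S \<le> 1" by (cases "finite S") (auto simp: card_le_Suc0_iff_eq)
    then show "S \<subseteq> states A" "card S \<le> 1" using S move_target[OF i] by auto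
  qed
  have code: "finite (transl A q)" "transl A q \<subseteq> lists (alphabet A)" "prefix_code (transl A q)"
    "\<And>x. x \<in> transl A q \<Longrightarrow> hd x \<notin> readable A q" if "q \<in> states A" for q
  proof -
    from state[OF that(1)] obtain i where i: "(q, i) \<in> P" by blast
    have "finite (words R i) \<and> words R i \<subseteq> lists (letters R)"
      using registers_bound[OF i] by (cases i) (auto simp: singles_def blocks_def letters_def)
    then show "finite (transl A q)" "transl A q \<subseteq> lists (alphabet A)" "prefix_code (transl A q)"
      using prefix_code_words by (simp_all add: transl_aut[OF i])
    show "hd x \<notin> readable A q" if "x \<in> transl A q" for x
      using that unfolding readable_aut[OF i] transl_aut[OF i]
      by (cases i) (auto simp: singles_def blocks_def)
  qed
  have rnf: "rnfawtw A"
    unfolding rnfawtw_def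
  proof (intro conjI ballI allI impI)
    show "finite (states A)" "finite (alphabet A)" "marker A \<notin> alphabet A"
      using finite_P finite_letters zero_not_letter by simp_all
    show "initials A \<subseteq> states A" using init by simp
  qed (rule letter goto(1) code; assumption)+
  show ?thesis
    unfolding rdfawtw_def
  proof (intro conjI ballI allI impI)
    show "rnfawtw A" by (rule rnf)
    show "card (initials A) = 1" by simp
  qed (rule goto(2); assumption)
qed

section \<open>Machine runs and automaton runs\<close>

lemma mstep_deterministic:
  assumes "mstep P c d" "mstep P c e"
  shows "d = e"
  using assms(1)
proof cases
  case start
  note i = functional[OF start(3)]
  from assms(2)[unfolded start(1)] show ?thesis by cases (auto simp: start dest!: i)
next
  case load
  note i = functional[OF load(3)]
  from assms(2)[unfolded load(1)] show ?thesis by cases (auto simp: load dest!: i)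
next
  case inc
  note i = functional[OF inc(3)]
  from assms(2)[unfolded inc(1)] show ?thesis by cases (auto simp: inc dest!: i)
next
  case dec
  note i = functional[OF dec(3)]
  from assms(2)[unfolded dec(1)] show ?thesis by cases (auto simp: dec dest!: i)
next
  case zero
  note i = functional[OF zero(3)]
  from assms(2)[unfolded zero(1)] show ?thesis by cases (auto simp: zero dest!: i)
qed

text \<open>Soundness of the simulation: the shape of the tape leaves the automaton no freedom in
  what it skips, apart from which token of the right colour it deletes, which does not affect the
  counts.\<close>

lemma step_mstep:
  assumes "tape R s w" "step A (Config q w) X" "X \<noteq> Reject"
  shows "(X = Accept \<and> (\<exists>r. (q, Stop r) \<in> P \<and> s r = 0)) \<or>
    (\<exists>q' s' w'. X = Config q' w' \<and> mstep P (q, s) (q', s') \<and> tape R s' w')"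
proof -
  obtain u v where w: "w = u @ v" "tokens R s u" "v \<in> kstar (blocks R)"
    using assms(1) unfolding tape_def by blast
  note u = tokens_range[OF w(2)]
  have absent: "s r = 0" if "w \<in> kstar (singles ({..<R} - {r}) \<union> blocks R)" for r
    using tokens_parsed[OF u that[unfolded w(1)]] by (intro tokens_absent[OF w(2)]) auto
  from assms(2) show ?thesis
  proof cases
    case (read x a y S q')
    from state[OF read(3)] obtain i where i: "(q, i) \<in> P" by blast
    have x: "x \<in> kstar (words R i)" and a: "a \<in> letters R" and q': "(a, q' + 2) \<in> moves i"
      using read zero_not_letter
      by (auto simp: transl_aut[OF i] readable_aut[OF i] delta_aut[OF i] split: if_splits)
    have split: "x @ a # y = u @ v" using read(1) w(1) by simp
    \<comment> \<open>Deleting the first seal sets the token of its block free, which raises exactly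
      one count.\<close>
    have push: "\<exists>w'. X = Config q' w' \<and> tape R (s(r := Suc (s r))) w' \<and> x = u"
      if xr: "set x \<subseteq> range token" and ar: "a = seal r" for r
    proof -
      obtain v' where v': "x = u" "y = token r # v'" "v' \<in> kstar (blocks R)" "r < R"
        using sealed_parsed[OF u w(3) xr split[unfolded ar]] .
      then have "tape R (s(r := Suc (s r))) (x @ y)"
        unfolding tape_def using tokens_snoc[OF w(2) v'(4)]
        by (intro exI[of _ "u @ [token r]"] exI[of _ v']) simp
      then show ?thesis using read(2) v'(1) by blast
    qed
    show ?thesis
    proof (cases i)
      case (Load p)
      have x0: "set x \<subseteq> token ` {0}" using x Load kstar_singles[of x "{0}"] by simp
      obtain w' where w': "X = Config q' w'" "tape R (s(0 := Suc (s 0))) w'" "x = u"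
        using push[of 0] x0 q' Load by auto
      \<comment> \<open>All of \<open>u\<close> was skipped with tokens of colour 0 alone, so no
        other colour is free.\<close>
      then have "s j = 0" if "j \<noteq> 0" for j
        using x0 that by (intro tokens_absent[OF w(2)]) auto
      then have "mstep P (q, s) (q', s(0 := Suc (s 0)))"
        using i q' Load by (intro mstep.load) auto
      with w' show ?thesis by blast
    next
      case (Inc r p)
      then have "set x \<subseteq> range token" using x kstar_singles[of x "{..<R}"] by auto
      then obtain w' where w': "X = Config q' w'" "tape R (s(r := Suc (s r))) w'"
        using push[of r] q' Inc by auto
      have "mstep P (q, s) (q', s(r := Suc (s r)))"
        using i q' Inc by (intro mstep.inc) auto
      with w' show ?thesis by blast
    next
      case (Dec r p p')
      then have ar: "a = token r" "q' = p" using q' a zero_not_letter by auto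
      obtain u' where u': "u = x @ token r # u'" "y = u' @ v"
        using token_parsed[OF u w(3) _ split[unfolded ar(1)]] x Dec by (metis words.simps(5))
      have "token r \<in> set u" using u'(1) by simp
      then have "s r \<noteq> 0" using w(2) count_list_0_iff unfolding tokens_def by metis
      then obtain n where n: "s r = Suc n" using not0_implies_Suc by blast
      have "tape R (s(r := n)) (x @ y)"
        unfolding tape_def using tokens_remove[OF w(2)[unfolded u'(1)] n] u'(2) w(3)
        by (intro exI[of _ "x @ u'"] exI[of _ v]) simp
      moreover have "mstep P (q, s) (q', s(r := n))"
        using i n Dec ar by (intro mstep.dec) auto
      ultimately show ?thesis using read(2) by blast
    qed (use q' a zero_not_letter in auto)
  next
    case end_accept
    from state[OF end_accept(2)] obtain i where i: "(q, i) \<in> P" by blast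
    then obtain r where "i = Stop r"
      using end_accept(4) by (cases i) (auto simp: delta_aut[OF i])
    then show ?thesis using end_accept absent[of r] i by (auto simp: transl_aut[OF i])
  next
    case (end_goto S q')
    from state[OF end_goto(2)] obtain i where i: "(q, i) \<in> P" by blast
    have q': "(0, q' + 2) \<in> moves i"
      using end_goto by (auto simp: delta_aut[OF i] split: if_splits)
    show ?thesis
    proof (cases i)
      case (Start p)
      \<comment> \<open>The words of \<open>Start\<close> are blocks without any single token, which
        is the case of an empty colour set.\<close>
      then have "set u \<subseteq> token ` {}"
        using end_goto(3) w(1) tokens_parsed[OF u, of v "{}" R]
        by (simp add: transl_aut[OF i] singles_def)
      then have "s = (\<lambda>_. 0)" using w(2) by (auto simp: tokens_def)
      then have "mstep P (q, s) (q', s)"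
        using i Start q' by (auto intro: mstep.start)
      then show ?thesis using end_goto(1) assms(1) by blast
    next
      case (Dec r p p')
      then have "s r = 0" using absent end_goto(3) by (simp add: transl_aut[OF i])
      then have "mstep P (q, s) (q', s)"
        using i Dec q' by (auto intro: mstep.zero)
      then show ?thesis using end_goto(1) assms(1) by blast
    qed (use q' in auto)
  qed (use assms(3) in auto)
qed

text \<open>Completeness: \<open>d\<close> is the part of the guessed input that the step uses up.
  It is chosen before \<open>u\<close> and \<open>v\<close>, so the pieces of successive steps can
  be concatenated.\<close>

lemma mstep_step:
  assumes "mstep P (q, s) (q', s')"
  shows "\<exists>d\<in>kstar (blocks R). \<forall>u v. tokens R s u \<longrightarrow> v \<in> kstar (blocks R) \<longrightarrow>
    (\<exists>u'. tokens R s' u' \<and> step A (Config q (u @ d @ v)) (Config q' (u' @ v)))"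
proof -
  \<comment> \<open>An increment uses up one block of its colour.\<close>
  have push: ?thesis if i: "(q, i) \<in> P" and m: "moves i = {(seal r, q' + 2)}" and r: "r < R"
    and parse: "\<And>u. tokens R s u \<Longrightarrow> u \<in> kstar (words R i)" and s': "s' = s(r := Suc (s r))" for i r
  proof (intro bexI allI impI)
    show "[seal r, token r] \<in> kstar (blocks R)"
      using r by (intro kstar_word) (auto simp: blocks_def)
    fix u v assume u: "tokens R s u" and v: "v \<in> kstar (blocks R)"
    have "step A (Config q (u @ seal r # token r # v)) (Config q' (u @ token r # v))"
    proof (rule step.read)
      show "q \<in> states A" using i by force
      show "u \<in> kstar (transl A q)" using parse[OF u] by (simp add: transl_aut[OF i])
      show "seal r \<in> readable A q" using m r by (auto simp: readable_aut[OF i] letters_def)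
      show "token r # v \<in> lists (alphabet A)" using r blocks_letters[OF v] by (auto simp: letters_def)
      show "delta A q (seal r) = Goto {q'}" using m by (auto simp: delta_aut[OF i])
    qed simp
    then show "\<exists>u'. tokens R s' u' \<and> step A (Config q (u @ [seal r, token r] @ v)) (Config q' (u' @ v))"
      using tokens_snoc[OF u r] unfolding s' by (intro exI[of _ "u @ [token r]"]) simp
  qed
  \<comment> \<open>A move at the end marker leaves the tape alone, so nothing has to be
    guessed.\<close>
  have skip: ?thesis if i: "(q, i) \<in> P" and m: "(0, q' + 2) \<in> moves i" "(0, 0) \<notin> moves i"
    and parse: "\<And>u v. tokens R s u \<Longrightarrow> v \<in> kstar (blocks R) \<Longrightarrow> u @ v \<in> kstar (words R i)"
    and s': "s' = s" for i
  proof (intro bexI[OF _ kstar_Nil] allI impI)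
    fix u v assume uv: "tokens R s u" "v \<in> kstar (blocks R)"
    have "step A (Config q (u @ v)) (Config q' (u @ v))"
    proof (rule step.end_goto)
      show "q \<in> states A" using i by force
      show "u @ v \<in> kstar (transl A q)" using parse[OF uv] by (simp add: transl_aut[OF i])
      show "delta A q (marker A) = Goto {q'. (0, q' + 2) \<in> moves i}"
        using m by (simp add: delta_aut[OF i])
    qed (use m in simp)
    then show "\<exists>u'. tokens R s' u' \<and> step A (Config q (u @ [] @ v)) (Config q' (u' @ v))"
      using uv unfolding s' by auto
  qed
  from assms show ?thesis
  proof cases
    case start
    then show ?thesis by (intro skip[of "Start q'"]) (auto simp: tokens_zero)
  next
    case load
    have "u \<in> kstar (words R (Load q'))" if "tokens R s u" for u
      using tokens_avoid[OF that, of "{0}"] load by (auto simp: kstar_singles)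
    then show ?thesis using load registers_bound[OF load(2)] by (intro push[of "Load q'" 0]) auto
  next
    case (inc r)
    have "u \<in> kstar (words R (Inc r q'))" if "tokens R s u" for u
      using that by (auto simp: kstar_singles tokens_def)
    then show ?thesis using inc registers_bound[OF inc(2)] by (intro push[of "Inc r q'" r]) auto
  next
    case (dec r p n)
    have i: "(q, Dec r q' p) \<in> P" by (rule dec)
    show ?thesis
    proof (intro bexI[OF _ kstar_Nil] allI impI)
      fix u v assume u: "tokens R s u" and v: "v \<in> kstar (blocks R)"
      have "token r \<in> set u" using u dec(3) count_list_0_iff[of u "token r"] by (auto simp: tokens_def)
      \<comment> \<open>With the first token of colour \<open>r\<close>, everything in front of it
        has another colour and is translucent.\<close>
      then obtain x y where xy: "u = x @ token r # y" "token r \<notin> set x"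
        by (meson split_list_first)
      have tu: "set u \<subseteq> token ` {..<R}" using u by (simp add: tokens_def)
      have "step A (Config q (x @ token r # y @ v)) (Config q' (x @ y @ v))"
      proof (rule step.read)
        show "q \<in> states A" using i by force
        have "set x \<subseteq> token ` ({..<R} - {r})" using tu xy by auto
        from kstar_tokens_blocks[OF this kstar_Nil] show "x \<in> kstar (transl A q)"
          by (simp add: transl_aut[OF i])
        show "token r \<in> readable A q" using registers_bound[OF i]
          by (auto simp: readable_aut[OF i] letters_def)
        show "y @ v \<in> lists (alphabet A)"
          using tokens_letters[OF u] blocks_letters[OF v] by (simp add: xy(1))
        show "delta A q (token r) = Goto {q'}" by (auto simp: delta_aut[OF i])
      qed simp
      then show "\<exists>u'. tokens R s' u' \<and> step A (Config q (u @ [] @ v)) (Config q' (u' @ v))"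
        using tokens_remove[OF u[unfolded xy(1)] dec(3)] dec(1) xy(1)
        by (intro exI[of _ "x @ y"]) simp
    qed
  next
    case (zero r p)
    have "u @ v \<in> kstar (words R (Dec r p q'))" if "tokens R s u" "v \<in> kstar (blocks R)" for u v
    proof -
      have "set u \<subseteq> token ` ({..<R} - {r})"
        using tokens_avoid[OF that(1), of "- {r}"] zero(3) by auto
      then show ?thesis using kstar_tokens_blocks that(2) by simp
    qed
    then show ?thesis using zero by (intro skip[of "Dec r p q'"]) auto
  qed
qed

text \<open>Seals are deleted from left to right, so the piece of the first step stands in front of
  the pieces of the later ones.\<close>

lemma msteps_steps:
  assumes "(mstep P)\<^sup>*\<^sup>* (q, s) (q', s')"
  shows "\<exists>d\<in>kstar (blocks R). \<forall>u v. tokens R s u \<longrightarrow> v \<in> kstar (blocks R) \<longrightarrow>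
    (\<exists>u'. tokens R s' u' \<and> (step A)\<^sup>*\<^sup>* (Config q (u @ d @ v)) (Config q' (u' @ v)))"
  using assms
proof (induction rule: converse_rtranclp_induct2)
    case refl
    show ?case by (intro bexI[of _ "[]"]) (auto simp: kstar_Nil)
  next
    case (step q s p t)
    obtain d where d: "d \<in> kstar (blocks R)"
      "\<And>u v. tokens R s u \<Longrightarrow> v \<in> kstar (blocks R) \<Longrightarrow>
        \<exists>u'. tokens R t u' \<and> step A (Config q (u @ d @ v)) (Config p (u' @ v))"
      using mstep_step[OF step(1)] by meson
    from step.IH obtain e where e: "e \<in> kstar (blocks R)"
      "\<And>u v. tokens R t u \<Longrightarrow> v \<in> kstar (blocks R) \<Longrightarrow>
        \<exists>u'. tokens R s' u' \<and> (step A)\<^sup>*\<^sup>* (Config p (u @ e @ v)) (Config q' (u' @ v))"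
      by meson
    have "\<exists>u'. tokens R s' u' \<and> (step A)\<^sup>*\<^sup>* (Config q (u @ (d @ e) @ v)) (Config q' (u' @ v))"
      if u: "tokens R s u" and v: "v \<in> kstar (blocks R)" for u v
    proof -
      obtain u1 where u1: "tokens R t u1" "step A (Config q (u @ d @ e @ v)) (Config p (u1 @ e @ v))"
        using d(2)[OF u kstar_append[OF e(1) v]] by blast
      obtain u2 where "tokens R s' u2" "(step A)\<^sup>*\<^sup>* (Config p (u1 @ e @ v)) (Config q' (u2 @ v))"
        using e(2)[OF u1(1) v] by blast
      then show ?thesis using converse_rtranclp_into_rtranclp[of "step A", OF u1(2)]
        by (intro exI[of _ u2]) simp
    qed
    then show ?case using kstar_append[OF d(1) e(1)] by blast
qed

lemma language_nonempty_iff: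
  "language A \<noteq> {} \<longleftrightarrow>
     (\<exists>q r t. (mstep P)\<^sup>*\<^sup>* (0, \<lambda>_. 0) (q, t) \<and> (q, Stop r) \<in> P \<and> t r = 0)"
proof
  assume "language A \<noteq> {}"
  then obtain w where w: "(step A)\<^sup>*\<^sup>* (Config 0 w) Accept"
    unfolding language_def by auto
  obtain p where p: "(0, Start p) \<in> P" using start_label by blast
  from w obtain X where X: "step A (Config 0 w) X" "(step A)\<^sup>*\<^sup>* X Accept"
    by (cases rule: converse_rtranclpE) auto
  have final: False if "(step A)\<^sup>*\<^sup>* Reject Accept"
    using that by (cases rule: converse_rtranclpE) (auto elim: step.cases)
  from X have "X \<noteq> Reject" using final by blast
  \<comment> \<open>The \<open>Start\<close> state reads no letter, so its only step other than
    rejection needs the whole input to be parsed into blocks.\<close>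
  with X(1) have "w \<in> kstar (blocks R)"
    by cases (use transl_aut[OF p] readable_aut[OF p] zero_not_letter in auto)
  then have "tape R (\<lambda>_. 0) w"
    unfolding tape_def using tokens_zero by (intro exI[of _ "[]"] exI[of _ w]) simp
  moreover have "\<exists>q' r t. (mstep P)\<^sup>*\<^sup>* (q, s) (q', t) \<and> (q', Stop r) \<in> P \<and> t r = 0"
    if "(step A)\<^sup>*\<^sup>* X Accept" "X = Config q w" "tape R s w" for X q w s
    using that
  proof (induction arbitrary: q w s rule: converse_rtranclp_induct)
    case base
    then show ?case by simp
  next
    case (step X Y)
    have "Y \<noteq> Reject" using step.hyps(2) final by blast
    from step_mstep[OF step.prems(2) step.hyps(1)[unfolded step.prems(1)] this]
    show ?case
    proof (elim disjE exE conjE)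
      fix q' s' w' assume *: "Y = Config q' w'" "mstep P (q, s) (q', s')" "tape R s' w'"
      from step.IH[OF *(1,3)] show ?case
        using converse_rtranclp_into_rtranclp[of "mstep P", OF *(2)] by blast
    qed blast
  qed
  ultimately show "\<exists>q r t. (mstep P)\<^sup>*\<^sup>* (0, \<lambda>_. 0) (q, t) \<and> (q, Stop r) \<in> P \<and> t r = 0"
    using w by blast
next
  assume "\<exists>q r t. (mstep P)\<^sup>*\<^sup>* (0, \<lambda>_. 0) (q, t) \<and> (q, Stop r) \<in> P \<and> t r = 0"
  then obtain q r t where run: "(mstep P)\<^sup>*\<^sup>* (0, \<lambda>_. 0) (q, t)" and q: "(q, Stop r) \<in> P" "t r = 0"
    by blast
  obtain d where d: "d \<in> kstar (blocks R)" "\<And>u v. tokens R (\<lambda>_. 0) u \<Longrightarrow> v \<in> kstar (blocks R) \<Longrightarrow>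
      \<exists>u'. tokens R t u' \<and> (step A)\<^sup>*\<^sup>* (Config 0 (u @ d @ v)) (Config q (u' @ v))"
    using msteps_steps[OF run] by meson
  obtain u where u: "tokens R t u" "(step A)\<^sup>*\<^sup>* (Config 0 d) (Config q u)"
    using d(2)[of "[]" "[]"] by (auto simp: tokens_zero kstar_Nil)
  have "step A (Config q u) Accept"
  proof (rule step.end_accept)
    show "q \<in> states A" using q(1) by force
    have "set u \<subseteq> token ` ({..<R} - {r})"
      using tokens_avoid[OF u(1), of "- {r}"] q(2) by auto
    from kstar_tokens_blocks[OF this kstar_Nil] show "u \<in> kstar (transl A q)"
      by (simp add: transl_aut[OF q(1)])
    show "delta A q (marker A) = Acc" by (simp add: delta_aut[OF q(1)])
  qed
  with u(2) have "d \<in> language A"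
    using blocks_letters[OF d(1)] unfolding language_def by auto
  then show "language A \<noteq> {}" by blast
qed

end

section \<open>Structured programs as instruction tables\<close>

fun vars :: "com \<Rightarrow> nat set" where
  "vars SKIP = {}"
| "vars (INC r) = {r}"
| "vars (c ;; d) = vars c \<union> vars d"
| "vars (LOOP r c) = insert r (vars c)"

lemma finite_vars: "finite (vars c)"
  by (induction c) auto

fun width :: "com \<Rightarrow> nat" where
  "width SKIP = 0"
| "width (INC r) = 1"
| "width (c ;; d) = width c + width d"
| "width (LOOP r c) = Suc (width c)"

text \<open>
  In \<open>entry c x p\<close> and \<open>flatten c x p\<close>, the label \<open>x\<close> is where control goes after \<open>c\<close>, and the
  instructions of \<open>c\<close> get the labels \<open>p + 1, \<dots>, p + width c\<close>.
\<close>

fun entry :: "com \<Rightarrow> nat \<Rightarrow> nat \<Rightarrow> nat" where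
  "entry SKIP x p = x"
| "entry (INC r) x p = Suc p"
| "entry (c ;; d) x p = entry c (entry d x p) (p + width d)"
| "entry (LOOP r c) x p = Suc p"

fun flatten :: "com \<Rightarrow> nat \<Rightarrow> nat \<Rightarrow> (nat \<times> instr) set" where
  "flatten SKIP x p = {}"
| "flatten (INC r) x p = {(Suc p, Inc r x)}"
| "flatten (c ;; d) x p = flatten c (entry d x p) (p + width d) \<union> flatten d x p"
| "flatten (LOOP r c) x p =
     insert (Suc p, Dec r (entry c (Suc p) (Suc p)) x) (flatten c (Suc p) (Suc p))"

lemma finite_flatten: "finite (flatten c x p)"
  by (induction c arbitrary: x p) auto

text \<open>The first alternative covers commands without instructions, where control is at the exit
  label at once.\<close>

lemma entry_bound: "entry c x p = x \<or> p < entry c x p \<and> entry c x p \<le> p + width c"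
proof (induction c arbitrary: x p)
  case (SEQ c d)
  show ?case using SEQ.IH(1)[of "entry d x p" "p + width d"] SEQ.IH(2)[of x p] by auto
qed auto

lemma flatten_labels: "fst ` flatten c x p = {p<..p + width c}"
  by (induction c arbitrary: x p) (auto simp: image_Un)

lemma flatten_label:
  assumes "(q, i) \<in> flatten c x p"
  shows "p < q" "q \<le> p + width c"
  using flatten_labels[of c x p] assms by force+

lemma flatten_registers: "(q, i) \<in> flatten c x p \<Longrightarrow> registers i \<subseteq> vars c"
  by (induction c arbitrary: x p) (auto, blast+)

lemma flatten_targets:
  "(q, i) \<in> flatten c x p \<Longrightarrow> targets i \<subseteq> insert x {p<..p + width c}"
proof (induction c arbitrary: x p)
  case (SEQ c d)
  then show ?case using entry_bound[of d x p] by fastforce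
next
  case (LOOP r c)
  then show ?case using entry_bound[of c "Suc p" "Suc p"] by fastforce
qed auto

text \<open>In a sequence the labels of the second command lie below those of the first.\<close>

lemma flatten_functional: "(q, i) \<in> flatten c x p \<Longrightarrow> (q, j) \<in> flatten c x p \<Longrightarrow> i = j"
proof (induction c arbitrary: x p)
  case (SEQ c d)
  have "\<not> ((q, i) \<in> flatten c (entry d x p) (p + width d) \<and> (q, j) \<in> flatten d x p)" for i j
    using flatten_label(1)[of q i c "entry d x p" "p + width d"] flatten_label(2)[of q j d x p]
    by linarith
  with SEQ show ?case by auto
next
  case (LOOP r c)
  then show ?case by (auto dest: flatten_label)
qed auto

text \<open>The body of a loop has the loop head \<open>Suc p\<close> as its exit label, so every
  round leads back to the test.\<close>

lemma exec_msteps: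
  assumes "exec c s t" "flatten c x p \<subseteq> P"
  shows "(mstep P)\<^sup>*\<^sup>* (entry c x p, s) (x, t)"
  using assms
proof (induction arbitrary: x p rule: exec.induct)
  case (skip s)
  then show ?case by simp
next
  case (inc r s)
  then have "mstep P (Suc p, s) (x, s(r := Suc (s r)))"
    by (intro mstep.inc) simp
  then show ?case unfolding entry.simps by (rule r_into_rtranclp)
next
  case (seq c s t d u)
  then have "(mstep P)\<^sup>*\<^sup>* (entry c (entry d x p) (p + width d), s) (entry d x p, t)"
    "(mstep P)\<^sup>*\<^sup>* (entry d x p, t) (x, u)"
    by simp_all
  then show ?case by simp
next
  case (loop_end s r c)
  then show ?case by (auto intro: mstep.zero)
next
  case (loop_step s r n c t u)
  then have "mstep P (Suc p, s) (entry c (Suc p) (Suc p), s(r := n))"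
    by (auto intro: mstep.dec)
  also have "(mstep P)\<^sup>*\<^sup>* (entry c (Suc p) (Suc p), s(r := n)) (Suc p, t)"
    by (rule loop_step.IH(1)) (use loop_step.prems in simp)
  also have "(mstep P)\<^sup>*\<^sup>* (Suc p, t) (x, u)"
    using loop_step.IH(2)[OF loop_step.prems] by simp
  finally show ?case by simp
qed

section \<open>Loading the input\<close>

definition loader :: "nat \<Rightarrow> nat \<Rightarrow> (nat \<times> instr) set" where
  "loader L n = (\<lambda>m. (Suc (L + m), Load (L + m))) ` {..<n}"

lemma loader_msteps:
  assumes "loader L n \<subseteq> P"
  shows "(mstep P)\<^sup>*\<^sup>* (L + n, (\<lambda>_. 0)(0 := k)) (L, (\<lambda>_. 0)(0 := k + n))"
  using assms
proof (induction n arbitrary: k)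
  case (Suc n)
  let ?s = "(\<lambda>_. 0)(0 := k) :: nat \<Rightarrow> nat"
  have "(Suc (L + n), Load (L + n)) \<in> P"
    using Suc.prems by (auto simp: loader_def)
  then have "mstep P (Suc (L + n), ?s) (L + n, (\<lambda>_. 0)(0 := Suc k))"
    using mstep.load[of _ _ P ?s] by simp
  also have "(mstep P)\<^sup>*\<^sup>* (L + n, (\<lambda>_. 0)(0 := Suc k)) (L, (\<lambda>_. 0)(0 := Suc k + n))"
    by (rule Suc.IH) (use Suc.prems in \<open>auto simp: loader_def\<close>)
  finally show ?case by (simp only: add_Suc_right add_Suc)
qed simp

text \<open>Label 0 is the start, 1 the stop, and the command occupies 2 up to this label. The
  loader lies above, so the labels of \<open>core\<close> do not depend on \<open>n\<close>.\<close>

definition top_label :: "com \<Rightarrow> nat" where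
  "top_label c = Suc (width c)"

definition core :: "com \<Rightarrow> (nat \<times> instr) set" where
  "core c = insert (1, Stop 1) (flatten c 1 1)"

definition loaded :: "com \<Rightarrow> nat \<Rightarrow> (nat \<times> instr) set" where
  "loaded c n = insert (0, Start (top_label c + n)) (loader (top_label c) n \<union> core c)"

lemma program_loaded:
  assumes "vars c \<subseteq> {..<R}" "1 < R"
  shows "program R (loaded c n)"
proof
  let ?L = "top_label c"
  have core_label: "0 < q \<and> q \<le> ?L" if "(q, i) \<in> core c" for q i
    using that flatten_label[of q i c 1 1] by (auto simp: core_def top_label_def)
  have loader_label: "?L < q" if "(q, i) \<in> loader ?L n" for q i
    using that by (auto simp: loader_def)
  show "finite (loaded c n)"
    by (simp add: loaded_def core_def loader_def finite_flatten)
  show "i = j" if "(q, i) \<in> loaded c n" "(q, j) \<in> loaded c n" for q i j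
  proof -
    have "i = j" if "(q, i) \<in> core c" "(q, j) \<in> core c"
      using that by (auto simp: core_def dest: flatten_label flatten_functional)
    moreover have "i = j" if "(q, i) \<in> loader ?L n" "(q, j) \<in> loader ?L n"
      using that by (auto simp: loader_def)
    ultimately show ?thesis
      using that core_label loader_label by (fastforce simp: loaded_def)
  qed
  show "\<exists>q. (0, Start q) \<in> loaded c n" by (auto simp: loaded_def)
  show "registers i \<subseteq> {..<R}" if "(q, i) \<in> loaded c n" for q i
    using that assms flatten_registers[of q i c 1 1]
    by (auto simp: loaded_def core_def loader_def)
  have core_labels: "fst ` core c = {0<..?L}"
    by (auto simp: core_def flatten_labels top_label_def)
  have "fst ` loader ?L n = {?L<..?L + n}"
  proof
    show "{?L<..?L + n} \<subseteq> fst ` loader ?L n"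
    proof
      fix q assume "q \<in> {?L<..?L + n}"
      then show "q \<in> fst ` loader ?L n"
        unfolding loader_def image_image by (intro image_eqI[of _ _ "q - Suc ?L"]) auto
    qed
  qed (auto simp: loader_def)
  then have labels: "fst ` loaded c n = {..?L + n}"
    unfolding loaded_def by (auto simp: image_Un core_labels)
  have "targets i \<subseteq> {..?L + n}" if "(q, i) \<in> flatten c 1 1" for q i
    by (rule order_trans[OF flatten_targets[OF that]]) (auto simp: top_label_def)
  then show "targets i \<subseteq> fst ` loaded c n" if "(q, i) \<in> loaded c n" for q i
    using that unfolding labels by (fastforce simp: loaded_def core_def loader_def)
qed

section \<open>The diagonal argument\<close>

lemma (in program) is_listingI:
  assumes "set qs = fst ` P" "set as = letters R"
    "set ts = {(q, x). \<exists>i. (q, i) \<in> P \<and> x \<in> words R i}"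
    "set ds = {(q, a, c). \<exists>i. (q, i) \<in> P \<and> (a, c) \<in> moves i}"
  shows "is_listing (qs, as, 0, ts, [0], ds) A"
proof -
  have entries: "a \<in> insert 0 (letters R) \<and> c \<in> entries (delta A q a) \<longleftrightarrow> (a, c) \<in> moves i"
    if "(q, i) \<in> P" for q i a c
    using registers_bound[OF that]
    by (cases i) (auto simp: delta_aut[OF that] letters_def image_iff Suc_le_eq)
  have "set ts = {(q, x). q \<in> states A \<and> x \<in> transl A q}"
    unfolding assms(3) using transl_aut by force
  moreover have "set ds = {(q, a, c). q \<in> states A \<and> a \<in> insert (marker A) (alphabet A) \<and>
      c \<in> entries (delta A q a)}"
  proof -
    have "(\<exists>i. (q, i) \<in> P \<and> (a, c) \<in> moves i) \<longleftrightarrow> q \<in> states A \<and>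
        a \<in> insert (marker A) (alphabet A) \<and> c \<in> entries (delta A q a)" for q a c
      using entries[of q _ a c] by (metis aut_sel(1-3) fst_conv image_eqI state)
    then show ?thesis unfolding assms(4) by simp
  qed
  ultimately show ?thesis using assms(1,2) by simp
qed

text \<open>The step is the cons of \<open>list_encode\<close>, so a family of \<open>n\<close>
  entries, last index first, is put in front of a coded list by primitive recursion.\<close>

definition enlist :: "(nat \<Rightarrow> nat) \<Rightarrow> nat \<Rightarrow> nat \<Rightarrow> nat" where
  "enlist f c n = rec_nat c (\<lambda>m y. Suc (prod_encode (f m, y))) n"

lemma enlist_list_encode:
  "enlist f (list_encode xs) n = list_encode (map f (rev [0..<n]) @ xs)"
  by (induction n) (auto simp: enlist_def)

text \<open>\<open>q\<close>, \<open>a\<close>, \<open>t\<close>, \<open>d\<close> are codes of the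
  parts of the lists that do not depend on \<open>n\<close>. The outer
  \<open>Suc (prod_encode ...)\<close> is a cons: it adds the move of the initial state, whose
  target \<open>L + n\<close> varies.\<close>

definition instance_code :: "nat \<Rightarrow> nat \<Rightarrow> nat \<Rightarrow> nat \<Rightarrow> nat \<Rightarrow> nat \<Rightarrow> nat" where
  "instance_code L q a t d n = list_encode
     [enlist (\<lambda>m. Suc (L + m)) q n, a, 0,
      enlist (\<lambda>m. prod_encode (Suc (L + m), list_encode [token 0])) t n, list_encode [0],
      Suc (prod_encode (prod_encode (0, prod_encode (0, L + n + 2)),
        enlist (\<lambda>m. prod_encode (Suc (L + m), prod_encode (seal 0, L + m + 2))) d n))]"

text \<open>The constants are obtained before \<open>n\<close>; this uniformity permits
  \<open>n\<close> to be built from them later.\<close>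

lemma loaded_listing:
  assumes "vars c \<subseteq> {..<R}" "1 < R"
  obtains q a t d where "\<And>n. \<exists>l. is_listing l (aut R (loaded c n)) \<and>
    code l = instance_code (top_label c) q a t d n"
proof -
  let ?L = "top_label c"
  \<comment> \<open>\<open>Start 0\<close> stands in for the real start instruction, which has the
    same label and words for every target. Its move differs, so \<open>ds\<close> is built from
    \<open>core\<close> alone.\<close>
  let ?B = "insert (0, Start 0) (core c)"
  have finite: "finite ?B" "finite (core c)" by (auto simp: core_def finite_flatten)
  have finite_words: "finite (words R i)" and finite_moves: "finite (moves i)" for i
    by (cases i; simp add: singles_def blocks_def)+
  from finite_list[OF finite_imageI[OF finite(1), of fst]] obtain qs where qs: "set qs = fst ` ?B"
    by metis
  have "finite (letters R)" by (simp add: letters_def)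
  from finite_list[OF this] obtain as where as: "set as = letters R" by blast
  have "finite (\<Union>(q, i)\<in>?B. Pair q ` words R i)"
    by (rule finite_UN_I[OF finite(1)]) (simp only: split_beta finite_imageI finite_words)
  from finite_list[OF this] obtain ts where "set ts = (\<Union>(q, i)\<in>?B. Pair q ` words R i)"
    by blast
  then have ts: "set ts = {(q, x). \<exists>i. (q, i) \<in> ?B \<and> x \<in> words R i}" by auto
  have "finite (\<Union>(q, i)\<in>core c. Pair q ` moves i)"
    by (rule finite_UN_I[OF finite(2)]) (simp only: split_beta finite_imageI finite_moves)
  from finite_list[OF this] obtain ds where "set ds = (\<Union>(q, i)\<in>core c. Pair q ` moves i)"
    by blast
  then have ds: "set ds = {(q, a, c'). \<exists>i. (q, i) \<in> core c \<and> (a, c') \<in> moves i}" by auto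
  let ?T = "\<lambda>(q, x). prod_encode (q, list_encode x)"
  let ?D = "\<lambda>(q, a, c). prod_encode (q, prod_encode (a, c))"
  have "\<exists>l. is_listing l (aut R (loaded c n)) \<and> code l = instance_code ?L (list_encode qs)
      (list_encode as) (list_encode (map ?T ts)) (list_encode (map ?D ds)) n" for n
  proof -
    interpret program R "loaded c n" by (rule program_loaded[OF assms])
    have loaded_iff: "(q, i) \<in> loaded c n \<longleftrightarrow> q = 0 \<and> i = Start (?L + n) \<or>
        (\<exists>m<n. q = Suc (?L + m) \<and> i = Load (?L + m)) \<or> (q, i) \<in> core c" for q i
      by (auto simp: loaded_def loader_def)
    have ex: "(\<exists>i. (q, i) \<in> loaded c n \<and> X i) \<longleftrightarrow> q = 0 \<and> X (Start (?L + n)) \<or>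
        (\<exists>m<n. q = Suc (?L + m) \<and> X (Load (?L + m))) \<or> (\<exists>i. (q, i) \<in> core c \<and> X i)" for q X
      unfolding loaded_iff by blast
    let ?ms = "rev [0..<n]"
    let ?l = "(map (\<lambda>m. Suc (?L + m)) ?ms @ qs, as, 0 :: nat,
      map (\<lambda>m. (Suc (?L + m), [token 0])) ?ms @ ts, [0 :: nat],
      (0, 0, ?L + n + 2) # map (\<lambda>m. (Suc (?L + m), seal 0, ?L + m + 2)) ?ms @ ds)"
    have "is_listing ?l (aut R (loaded c n))"
    proof (rule is_listingI[OF _ as])
      show "set (map (\<lambda>m. Suc (?L + m)) ?ms @ qs) = fst ` loaded c n"
        unfolding loaded_def loader_def by (auto simp: qs image_Un image_image)
      show "set (map (\<lambda>m. (Suc (?L + m), [token 0])) ?ms @ ts) =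
          {(q, x). \<exists>i. (q, i) \<in> loaded c n \<and> x \<in> words R i}"
        unfolding set_append ts ex by (auto simp: singles_def)
      show "set ((0, 0, ?L + n + 2) # map (\<lambda>m. (Suc (?L + m), seal 0, ?L + m + 2)) ?ms @ ds) =
          {(q, a, c'). \<exists>i. (q, i) \<in> loaded c n \<and> (a, c') \<in> moves i}"
        unfolding set_append list.set ds ex by auto
    qed
    moreover have "code ?l = instance_code ?L (list_encode qs)
      (list_encode as) (list_encode (map ?T ts)) (list_encode (map ?D ds)) n"
      by (simp add: instance_code_def enlist_list_encode comp_def)
    ultimately show ?thesis by blast
  qed
  with that show thesis by blast
qed

lemma recursive_enlist:
  assumes "recursive (Suc (Suc k)) (\<lambda>ys. f (drop 2 ys) (ys ! 0))" "recursive k c" "recursive k n"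
  shows "recursive k (\<lambda>xs. enlist (f xs) (c xs) (n xs))"
  unfolding enlist_def
  by (intro recursive_rec_nat assms recursive_Suc recursive_prod_encode recursive_nth) simp

lemma recursive_instance_code:
  assumes "recursive k L" "recursive k q" "recursive k a" "recursive k t" "recursive k d"
    "recursive k n"
  shows "recursive k (\<lambda>xs. instance_code (L xs) (q xs) (a xs) (t xs) (d xs) (n xs))"
  unfolding instance_code_def list_encode.simps
  by (intro recursive_Suc recursive_prod_encode recursive_enlist recursive_add recursive_const
      recursive_drop assms recursive_nth) simp_all

lemma deterministic_halt:
  assumes det: "\<And>x y z. r x y \<Longrightarrow> r x z \<Longrightarrow> y = z"
    and b: "r\<^sup>*\<^sup>* a b" "\<And>z. \<not> r b z" and c: "r\<^sup>*\<^sup>* a c" "\<And>z. \<not> r c z"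
  shows "b = c"
  using b(1) c(1)
proof (induction rule: converse_rtranclp_induct)
  case base
  then show ?case using b(2) by (auto elim: converse_rtranclpE)
next
  case (step x y)
  from step.prems obtain z where "r x z" "r\<^sup>*\<^sup>* z c"
    using step.hyps(1) c(2) by (auto elim: converse_rtranclpE)
  then show ?case using step det by blast
qed

text \<open>The leading \<open>INC 1\<close> has no other purpose than making the entry of \<open>c\<close> its highest label.\<close>

lemma decide_loaded:
  assumes G: "computes G [n] y" and c: "c = INC 1 ;; compile G [0] 1 2"
    and R: "vars c \<subseteq> {..<R}" "1 < R"
  shows "language (aut R (loaded c n)) \<noteq> {} \<longleftrightarrow> y = 0"
proof -
  let ?P = "loaded c n"
  interpret program R ?P by (rule program_loaded[OF R])
  let ?s = "(\<lambda>_. 0)(0 := n) :: nat \<Rightarrow> nat"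
  \<comment> \<open>The leading increment spoils register 1, but compiled code works for any initial
    content of its output register.\<close>
  let ?u = "?s(1 := Suc (?s 1))"
  have "computes G (map ?u [0]) y" using G by simp
  then obtain t where t: "exec (compile G [0] 1 2) ?u t" "t 1 = y"
    by (rule compilesD[OF compiles_all, where k = 2 and out = 1]) auto
  have exec: "exec c ?s t" unfolding c by (rule exec.seq[OF exec.inc t(1)])
  have "mstep ?P (0, \<lambda>_. 0) (top_label c + n, \<lambda>_. 0)"
    by (rule mstep.start) (simp add: loaded_def)
  also have "(mstep ?P)\<^sup>*\<^sup>* (top_label c + n, \<lambda>_. 0) (top_label c, ?s)"
  proof -
    have "loader (top_label c) n \<subseteq> ?P" by (auto simp: loaded_def)
    moreover have "((\<lambda>_. 0)(0 := 0) :: nat \<Rightarrow> nat) = (\<lambda>_. 0)" by auto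
    ultimately show ?thesis using loader_msteps[of "top_label c" n ?P 0] by (simp only: add_0)
  qed
  also have "(mstep ?P)\<^sup>*\<^sup>* (top_label c, ?s) (1, t)"
  proof -
    have "entry c 1 1 = top_label c" by (simp add: c top_label_def)
    moreover have "flatten c 1 1 \<subseteq> ?P" by (auto simp: loaded_def core_def)
    ultimately show ?thesis using exec_msteps[OF exec] by metis
  qed
  finally have run: "(mstep ?P)\<^sup>*\<^sup>* (0, \<lambda>_. 0) (1, t)" .
  have halt: "\<not> mstep ?P (q, s) z" if "(q, Stop r) \<in> ?P" for q r s z
    using functional[OF that] by (auto elim!: mstep.cases)
  have stop: "(1, Stop 1) \<in> ?P" by (simp add: loaded_def core_def)
  \<comment> \<open>No step leaves a \<open>Stop\<close>, so by determinism every run that reaches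
    one ends in this same configuration.\<close>
  have "(q, t') = (1, t)" if "(mstep ?P)\<^sup>*\<^sup>* (0, \<lambda>_. 0) (q, t')" "(q, Stop r) \<in> ?P" for q r t'
    using mstep_deterministic that(1) halt[OF that(2)] run halt[OF stop]
    by (rule deterministic_halt)
  then have "(\<exists>q r t'. (mstep ?P)\<^sup>*\<^sup>* (0, \<lambda>_. 0) (q, t') \<and> (q, Stop r) \<in> ?P \<and> t' r = 0) \<longleftrightarrow> t 1 = 0"
    using run stop functional[OF stop] by (metis instr.inject(2) prod.inject)
  then show ?thesis unfolding language_nonempty_iff t(2) .
qed

theorem theorem20:
  "\<not> (\<exists>D. \<forall>(A :: (nat, nat) automaton) l.
        rdfawtw A \<longrightarrow> is_listing l A \<longrightarrow>
        computes D [code l] (if language A = {} then 1 else 0))"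
proof
  assume "\<exists>D. \<forall>(A :: (nat, nat) automaton) l. rdfawtw A \<longrightarrow> is_listing l A \<longrightarrow>
    computes D [code l] (if language A = {} then 1 else 0)"
  then obtain D where D: "computes D [code l] (if language A = {} then 1 else 0)"
    if "rdfawtw A" "is_listing l A" for A :: "(nat, nat) automaton" and l
    by blast
  let ?fst = "\<lambda>z. fst (prod_decode z)" and ?snd = "\<lambda>z. snd (prod_decode z)"
  \<comment> \<open>The argument \<open>z\<close> is used twice: as the tuple of constants and as
    the input to be loaded.\<close>
  let ?inst = "\<lambda>z. instance_code (?fst z) (?fst (?snd z)) (?fst (?snd (?snd z)))
      (?fst (?snd (?snd (?snd z)))) (?snd (?snd (?snd (?snd z)))) z"
  have "recursive 1 (\<lambda>xs. ?inst (xs ! 0))"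
    by (intro recursive_instance_code recursive_prod_decode recursive_nth) simp_all
  then obtain I where I: "computes I [z] (?inst z)" for z
    unfolding recursive_def by (metis One_nat_def length_Cons list.size(3) nth_Cons_0)
  \<comment> \<open>Negation turns the answer 1 for emptiness into 0, the output that is
    accepted.\<close>
  have "recursive 1 (\<lambda>xs. 1 - xs ! 0)"
    by (intro recursive_diff recursive_const recursive_nth) simp
  then obtain F where F: "computes F [z] (1 - z)" for z
    unfolding recursive_def by (metis One_nat_def length_Cons list.size(3) nth_Cons_0)
  define G where "G = Comp F [Comp D [I]]"
  define c where "c = INC 1 ;; compile G [0] 1 2"
  have "finite (vars c \<union> {1})" using finite_vars by simp
  then obtain R where R: "\<forall>r \<in> vars c \<union> {1}. r < R"
    using finite_nat_set_iff_bounded by blast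
  then have vars: "vars c \<subseteq> {..<R}" "1 < R" by auto
  obtain q a t d where listing: "\<And>n. \<exists>l. is_listing l (aut R (loaded c n)) \<and>
      code l = instance_code (top_label c) q a t d n"
    using loaded_listing[OF vars] by blast
  \<comment> \<open>There is no circularity: \<open>G\<close>, \<open>c\<close>, \<open>R\<close>
    and the four constants were all fixed before \<open>n\<close>.\<close>
  define n where "n = prod_encode (top_label c,
    prod_encode (q, prod_encode (a, prod_encode (t, d))))"
  let ?A = "aut R (loaded c n)"
  obtain l where l: "is_listing l ?A" and code: "code l = ?inst n"
    using listing[of n] by (auto simp: n_def)
  define b :: nat where "b = (if language ?A = {} then 1 else 0)"
  have "computes D [code l] b"
    unfolding b_def by (rule D[OF program.rdfawtw_aut[OF program_loaded[OF vars]] l])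
  then have "computes (Comp D [I]) [n] b"
    unfolding code using I by (intro computes.comp[where ys = "[?inst n]"]) simp_all
  then have "computes G [n] (1 - b)"
    unfolding G_def using F by (intro computes.comp[where ys = "[b]"]) simp_all
  \<comment> \<open>The language is nonempty iff \<open>1 - b = 0\<close>, that is, iff
    \<open>b = 1\<close>, that is, iff it is empty.\<close>
  from decide_loaded[OF this c_def vars] show False
    by (simp add: b_def split: if_splits)
qed

end
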